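(* Let $q$ be a prime power and let $\mathcal{X}$ be a degenerate quadric in $\mathbb{P}^4(\mathbb{F}_q)$. The code $C_2(\mathcal{X})$ is an $[n,k,d]_q$-code (length $n$, dimension $k$, minimum distance $d$) with the following parameters. (1) If $\mathcal{X}$ has rank 3, then $n=q^3+q^2+q+1$, $k=14$, $d=q^3-3q^2$. (2) If $\mathcal{X}$ has rank 4 and projective index $g(\mathcal{X})=2$, then $n=q^3+2q^2+q+1$, $k=14$, $d=q^3-2q^2+q$.
   Context: A quadric in $\mathbb{P}^4(\mathbb{F}_q)$ is the zero set $Z(f)$ of a nonzero form $f$ of degree 2 in $x_0,\dots,x_4$ over $\mathbb{F}_q$. Its rank is the smallest number of indeterminates appearing in $f$ after an invertible linear change of coordinates; it is degenerate if its rank is less than 5. The projective index $g(\mathcal{X})$ is the maximum dimension of a linear subspace (over $\mathbb{F}_q$) contained in $\mathcal{X}$. A rank 3 quadric is a cone with vertex a line over a non-degenerate plane conic; a rank 4 quadric with projective index 2 is a cone with vertex a point over a hyperbolic quadric of $\mathbb{P}^3(\mathbb{F}_q)$. Functional code: let $\mathcal{F}_2$ be the $\mathbb{F}_q$-vector space of forms of degree 2 in $x_0,\dots,x_4$ (with $0$). The code $C_2(\mathcal{X})$ is the image of the linear map $c:\mathcal{F}_2\to\mathbb{F}_q^{|\mathcal{X}|}$, $c(f)=(c_x(f))_{x\in\mathcal{X}(\mathbb{F}_q)}$, where $c_x(f)=f(x_0,\dots,x_4)/x_i^2$ for $x=(x_0:\dots:x_4)$ and $i$ the smallest index with $x_i\ne0$.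 The weight of $c(f)$ is $\#\mathcal{X}(\mathbb{F}_q)-\#(\mathcal{X}\cap Z(f))(\mathbb{F}_q)$; the minimum distance is the smallest weight of a nonzero codeword.
   Formalization: In (1) the values k=14 and d=q^3-3q^2 are asserted only for q≥4; for q=2,3 they are false (d would be -4 or 0, and k is 12 or 13). The length n in (1) and all of (2) are stated for every q. *)

theory Defs
  imports
    "HOL-Analysis.Analysis"
    "HOL-Library.Poly_Mapping"
    "HOL-Library.Function_Algebras"
begin

section \<open>Forms in the indeterminates $x_0,\dots,x_4$\<close>

text \<open>
  The indices of the five indeterminates are the elements \<open>0 < 1 < 2 < 3 < 4\<close> of the numeral
  type \<open>5\<close>.  Polynomials are formal objects: finitely supported maps from exponent vectors to
  coefficients, multiplied by the convolution product of \<open>Poly_Mapping\<close>.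
\<close>

type_synonym 'a poly5 = "(5 \<Rightarrow>\<^sub>0 nat) \<Rightarrow>\<^sub>0 'a"

definition forms :: "nat \<Rightarrow> ('a::field) poly5 set" where
  "forms h = {f. \<forall>m \<in> Poly_Mapping.keys f. (\<Sum>i\<in>UNIV. Poly_Mapping.lookup m i) = h}"

definition eval_form :: "('a::field) poly5 \<Rightarrow> 'a ^ 5 \<Rightarrow> 'a" where
  "eval_form f x =
     (\<Sum>m\<in>Poly_Mapping.keys f. Poly_Mapping.lookup f m * (\<Prod>i\<in>UNIV. (x $ i) ^ Poly_Mapping.lookup m i))"

definition const_poly :: "'a::field \<Rightarrow> 'a poly5" where
  "const_poly a = Poly_Mapping.single 0 a"

definition indet :: "5 \<Rightarrow> ('a::field) poly5" where
  "indet i = Poly_Mapping.single (Poly_Mapping.single i 1) 1"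

definition coord_change :: "('a::field) ^ 5 ^ 5 \<Rightarrow> 'a poly5 \<Rightarrow> 'a poly5" where
  "coord_change M f =
     (\<Sum>m\<in>Poly_Mapping.keys f. const_poly (Poly_Mapping.lookup f m) *
        (\<Prod>i\<in>UNIV. (\<Sum>j\<in>UNIV. const_poly (M $ i $ j) * indet j) ^ Poly_Mapping.lookup m i))"

definition indets :: "('a::field) poly5 \<Rightarrow> 5 set" where
  "indets f = (\<Union>m\<in>Poly_Mapping.keys f. Poly_Mapping.keys m)"

definition form_rank :: "('a::field) poly5 \<Rightarrow> nat" where
  "form_rank f = (LEAST r. \<exists>M. invertible M \<and> r = card (indets (coord_change M f)))"

definition degenerate_form :: "('a::field) poly5 \<Rightarrow> bool" where
  "degenerate_form f \<longleftrightarrow> form_rank f < 5"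


section \<open>Projective space and zero sets\<close>

definition proj_points :: "('a::field ^ 5) set set" where
  "proj_points = {vec.span {x} | x. x \<noteq> 0}"

definition zero_set :: "('a::field) poly5 \<Rightarrow> ('a ^ 5) set set" where
  "zero_set f = {P \<in> proj_points. \<forall>x\<in>P. eval_form f x = 0}"

definition points_of :: "('a::field ^ 5) set \<Rightarrow> ('a ^ 5) set set" where
  "points_of W = {P \<in> proj_points. P \<subseteq> W}"

text \<open>
  The projective dimension is integer valued, the empty projective subspace having dimension \<open>-1\<close>.
\<close>

definition proj_index :: "('a::{field,finite} ^ 5) set set \<Rightarrow> int" where
  "proj_index X =
     Max {int (vec.dim W) - 1 | W. vec.subspace W \<and> points_of W \<subseteq> X}"


section \<open>Functional codes\<close>

definition first_nz :: "('a::field) ^ 5 \<Rightarrow> 5" where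
  "first_nz x = Min {i. x $ i \<noteq> 0}"

text \<open>
  The coordinate of a codeword at a projective point is computed from an arbitrary representative;
  that the choice does not matter for forms of degree 2 is lemma \<open>form_value_eq\<close> below.
\<close>

definition form_value :: "('a::field) poly5 \<Rightarrow> ('a ^ 5) set \<Rightarrow> 'a" where
  "form_value f P = (let x = (SOME x. x \<in> P \<and> x \<noteq> 0) in eval_form f x / (x $ first_nz x)\<^sup>2)"

text \<open>
  Elements of the space of \<open>X\<close>-indexed tuples are represented by functions on all sets of vectors
  that vanish outside \<open>X\<close>.
\<close>

definition codeword :: "('a::field ^ 5) set set \<Rightarrow> 'a poly5 \<Rightarrow> ('a ^ 5) set \<Rightarrow> 'a" where
  "codeword X f = (\<lambda>P. if P \<in> X then form_value f P else 0)"

definition functional_code :: "('a::field ^ 5) set set \<Rightarrow> (('a ^ 5) set \<Rightarrow> 'a) set" where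
  "functional_code X = codeword X ` forms 2"

definition fun_scale :: "'a::field \<Rightarrow> ('p \<Rightarrow> 'a) \<Rightarrow> 'p \<Rightarrow> 'a" where
  "fun_scale a w = (\<lambda>p. a * w p)"

global_interpretation fun_vs: vector_space "fun_scale :: 'a::field \<Rightarrow> ('p \<Rightarrow> 'a) \<Rightarrow> 'p \<Rightarrow> 'a"
  by unfold_locales (auto simp: fun_scale_def fun_eq_iff algebra_simps)

definition weight :: "('p \<Rightarrow> 'a::zero) \<Rightarrow> nat" where
  "weight w = card {p. w p \<noteq> 0}"

definition min_distance :: "('p \<Rightarrow> 'a::field) set \<Rightarrow> nat" where
  "min_distance C = Min (weight ` (C - {0}))"

text \<open>
  \<open>C\<close> is an \<open>[n,k,d]\<close>-code whose coordinates are indexed by the finite set \<open>X\<close>.  The parameters are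
  integers so that expressions such as \<open>q ^ 3 - 3 * q ^ 2\<close> are not truncated.
\<close>

definition is_code :: "'p set \<Rightarrow> ('p \<Rightarrow> 'a::field) set \<Rightarrow> int \<Rightarrow> int \<Rightarrow> int \<Rightarrow> bool" where
  "is_code X C n k d \<longleftrightarrow>
     finite X \<and> fun_vs.subspace C \<and> (\<forall>w\<in>C. \<forall>p. p \<notin> X \<longrightarrow> w p = 0) \<and>
     int (card X) = n \<and> int (fun_vs.dim C) = k \<and> int (min_distance C) = d"


section \<open>Well-definedness and the weight formula\<close>

lemma eval_form_scale:
  assumes "f \<in> forms h"
  shows "eval_form f (a *s x) = a ^ h * eval_form f x"
proof -
  have "(\<Prod>i\<in>UNIV. ((a *s x) $ i) ^ Poly_Mapping.lookup m i) = a ^ h * (\<Prod>i\<in>UNIV. (x $ i) ^ Poly_Mapping.lookup m i)"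
    if "m \<in> Poly_Mapping.keys f" for m
  proof -
    have "(\<Sum>i\<in>UNIV. Poly_Mapping.lookup m i) = h"
      using assms that by (auto simp: forms_def)
    then show ?thesis
      by (simp add: power_mult_distrib prod.distrib power_sum flip: \<open>_ = h\<close>)
  qed
  then show ?thesis
    unfolding eval_form_def sum_distrib_left
    by (intro sum.cong) (simp_all add: algebra_simps)
qed

lemma first_nz_scale: "a \<noteq> 0 \<Longrightarrow> first_nz (a *s x) = first_nz x"
  by (simp add: first_nz_def)

lemma first_nz_nonzero:
  assumes "x \<noteq> 0"
  shows "x $ first_nz x \<noteq> 0"
proof -
  have "{i. x $ i \<noteq> 0} \<noteq> {}"
    using assms by (auto simp: vec_eq_iff)
  then have "Min {i. x $ i \<noteq> 0} \<in> {i. x $ i \<noteq> 0}"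
    by (intro Min_in) auto
  then show ?thesis
    by (simp add: first_nz_def)
qed

lemma proj_point_scale:
  assumes "P \<in> proj_points" "x \<in> P" "x \<noteq> 0" "y \<in> P"
  obtains a where "y = a *s x"
proof -
  from assms(1) obtain z where P: "P = vec.span {z}"
    by (auto simp: proj_points_def)
  obtain b where b: "x = b *s z"
    using assms(2) P by (auto simp: vec.span_singleton)
  obtain c where c: "y = c *s z"
    using assms(4) P by (auto simp: vec.span_singleton)
  have "b \<noteq> 0"
    using b assms(3) by auto
  then have "y = (c / b) *s x"
    by (simp add: b c vec.scale_scale)
  then show ?thesis
    by (rule that)
qed

lemma proj_point_nonzero:
  assumes "P \<in> proj_points"
  shows "\<exists>x. x \<in> P \<and> x \<noteq> 0"
  using assms by (auto simp: proj_points_def intro: vec.span_base)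

lemma form_value_eq:
  assumes "f \<in> forms 2" "P \<in> proj_points" "x \<in> P" "x \<noteq> 0"
  shows "form_value f P = eval_form f x / (x $ first_nz x)\<^sup>2"
proof -
  define y where "y = (SOME x. x \<in> P \<and> x \<noteq> 0)"
  have y: "y \<in> P \<and> y \<noteq> 0"
    unfolding y_def by (rule someI[of "\<lambda>x. x \<in> P \<and> x \<noteq> 0" x]) (use assms in simp)
  obtain a where a: "y = a *s x"
    using proj_point_scale assms y by blast
  have "a \<noteq> 0"
    using a y by auto
  then have "eval_form f y / (y $ first_nz y)\<^sup>2 = eval_form f x / (x $ first_nz x)\<^sup>2"
    by (simp add: a eval_form_scale[OF assms(1)] first_nz_scale power_mult_distrib)
  then show ?thesis
    by (simp add: form_value_def y_def Let_def)
qed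

lemma form_value_eq_0_iff:
  assumes "f \<in> forms 2" "P \<in> proj_points"
  shows "form_value f P = 0 \<longleftrightarrow> P \<in> zero_set f"
proof -
  obtain x where x: "x \<in> P" "x \<noteq> 0"
    using proj_point_nonzero assms(2) by blast
  have "form_value f P = 0 \<longleftrightarrow> eval_form f x = 0"
    using form_value_eq[OF assms x] first_nz_nonzero[OF x(2)] by simp
  also have "\<dots> \<longleftrightarrow> P \<in> zero_set f"
  proof
    assume 0: "eval_form f x = 0"
    have "eval_form f y = 0" if "y \<in> P" for y
      using proj_point_scale[OF assms(2) x that] eval_form_scale[OF assms(1)] 0 by (metis mult_zero_right)
    then show "P \<in> zero_set f"
      using assms(2) by (simp add: zero_set_def)
  qed (use x in \<open>simp add: zero_set_def\<close>)
  finally show ?thesis .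
qed

lemma weight_codeword:
  fixes X :: "('a::{field,finite} ^ 5) set set"
  assumes "f \<in> forms 2" "X \<subseteq> proj_points"
  shows "weight (codeword X f) = card X - card (X \<inter> zero_set f)"
proof -
  have "{P. codeword X f P \<noteq> 0} = X - (X \<inter> zero_set f)"
    using assms form_value_eq_0_iff by (auto simp: codeword_def)
  then show ?thesis
    by (simp add: weight_def card_Diff_subset)
qed

end

theory Submission
  imports Defs
begin

text \<open>
  For \<open>Q = eval_form f\<close> let the radical be the space of singular vectors orthogonal to everything with
  respect to the polar form; its dimension is \<open>5 - form_rank f\<close> in every characteristic.  Splitting off
  hyperbolic pairs turns \<open>Q\<close> into \<open>x\<^sub>0x\<^sub>1 + cx\<^sub>2\<^sup>2\<close> (rank 3) or \<open>x\<^sub>0x\<^sub>1 - x\<^sub>2x\<^sub>3\<close> (rank 4, projective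
  index 2).  Both cones are unions of \<open>q + 1\<close> planes, indexed by the projective line, that meet
  pairwise only in the vertex line, respectively in the vertex point.  Restricted to these planes, the
  coefficients of a second quadratic form \<open>g\<close> are binary forms in the parameter of the pencil, of degree
  at most 4, respectively at most 2.  Either all of them vanish, and then \<open>g\<close> is a multiple of \<open>f\<close>, or \<open>g\<close>
  vanishes on few planes and has many nonzeros on each of the others.  This bounds the weights from
  below and shows that the kernel of the evaluation map is spanned by \<open>f\<close>; the bounds are attained by
  pairs of hyperplanes meeting the cone in four planes.
\<close>

section \<open>Evaluation of forms and linear substitutions\<close>

text \<open>Counts are made on vectors instead of projective points. Each of them carries a factor
  \<open>q - 1\<close>, which is cancelled only when the code parameters are read off. The minimum
  distances come from the planes of the cone. A conic is parametrized in degree 2, so a quadratic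
  form restricted to it has degree 4. Four planes can be lost, and each of the other
  \<open>q - 3\<close> has \<open>q^2\<close> points off the vertex line, which gives
  \<open>(q - 3) * q^2\<close>. The planes of one family on the rank 4 cone are parametrized
  linearly, so only two can be lost. When the second form vanishes at the vertex point, each of the
  other \<open>q - 1\<close> planes keeps at least \<open>q * (q - 1)\<close> points, which gives
  \<open>q * (q - 1)^2\<close>. When it does not vanish there, a separate count gives the same
  bound. Characteristic 2 shapes the algebra: the polar form no longer determines \<open>Q\<close>,
  so radical, rank and coefficients are tied to values of \<open>Q\<close> itself. No basis of the
  code is built; its dimension follows from its cardinality.\<close>

lemma exhaust_5: "(i::5) = 0 \<or> i = 1 \<or> i = 2 \<or> i = 3 \<or> i = 4"
proof (induct i)
  case (of_int z)
  then have "z = 0 \<or> z = 1 \<or> z = 2 \<or> z = 3 \<or> z = 4" by fastforce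
  then show ?case by auto
qed

lemma UNIV_5: "UNIV = {0, 1, 2, 3, 4::5}"
  using exhaust_5 by auto

lemma sum_5: "sum f (UNIV::5 set) = f 0 + f 1 + f 2 + f 3 + f 4"
  unfolding UNIV_5 by (simp add: ac_simps)

lemma eval_form_superset:
  assumes "finite S" "Poly_Mapping.keys f \<subseteq> S"
  shows "eval_form f x =
    (\<Sum>m\<in>S. Poly_Mapping.lookup f m * (\<Prod>i\<in>UNIV. (x $ i) ^ Poly_Mapping.lookup m i))"
  unfolding eval_form_def
  by (rule sum.mono_neutral_left) (use assms in \<open>auto simp: in_keys_iff\<close>)

lemma eval_form_add: "eval_form (f + g) x = eval_form f x + eval_form g x"
proof -
  let ?S = "Poly_Mapping.keys f \<union> Poly_Mapping.keys g"
  have "Poly_Mapping.keys (f + g) \<subseteq> ?S" by (rule keys_add)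
  then show ?thesis
    by (simp add: eval_form_superset[of ?S] lookup_add algebra_simps sum.distrib)
qed

lemma eval_form_zero [simp]: "eval_form 0 x = 0"
  by (simp add: eval_form_def)

lemma eval_form_sum: "eval_form (\<Sum>i\<in>I. f i) x = (\<Sum>i\<in>I. eval_form (f i) x)"
  by (induct I rule: infinite_finite_induct) (simp_all add: eval_form_add)

lemma eval_form_single:
  "eval_form (Poly_Mapping.single m a) x = a * (\<Prod>i\<in>UNIV. (x $ i) ^ Poly_Mapping.lookup m i)"
  by (subst eval_form_superset[of "{m}"]) (auto simp: lookup_single when_def)

lemma poly_mapping_eq_sum_single:
  "f = (\<Sum>m\<in>Poly_Mapping.keys f. Poly_Mapping.single m (Poly_Mapping.lookup f m))"
proof (rule poly_mapping_eqI)
  fix k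
  have "(\<Sum>m\<in>Poly_Mapping.keys f. Poly_Mapping.lookup f m when m = k) =
      (\<Sum>m\<in>Poly_Mapping.keys f. if m = k then Poly_Mapping.lookup f m else 0)"
    by (simp add: when_def)
  also have "\<dots> = Poly_Mapping.lookup f k"
    by (simp add: in_keys_iff)
  finally show "Poly_Mapping.lookup f k =
      Poly_Mapping.lookup (\<Sum>m\<in>Poly_Mapping.keys f. Poly_Mapping.single m (Poly_Mapping.lookup f m)) k"
    by (simp add: lookup_sum lookup_single)
qed

lemma eval_form_mult: "eval_form (f * g) x = eval_form f x * eval_form g x"
proof -
  let ?mon = "\<lambda>m. \<Prod>i\<in>UNIV. (x $ i) ^ Poly_Mapping.lookup m i"
  have mon: "?mon (m + n) = ?mon m * ?mon n" for m n
    by (simp add: lookup_add power_add prod.distrib)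
  have "f * g = (\<Sum>m\<in>Poly_Mapping.keys f. \<Sum>n\<in>Poly_Mapping.keys g.
      Poly_Mapping.single (m + n) (Poly_Mapping.lookup f m * Poly_Mapping.lookup g n))"
    by (subst (1) poly_mapping_eq_sum_single[of f], subst (1) poly_mapping_eq_sum_single[of g])
      (simp add: sum_product mult_single)
  then show ?thesis
    by (simp add: eval_form_sum eval_form_single mon)
      (simp add: eval_form_def sum_product algebra_simps)
qed

lemma eval_form_one [simp]: "eval_form 1 x = 1"
  using eval_form_single[of 0 1 x] by simp

lemma eval_form_power: "eval_form (f ^ n) x = eval_form f x ^ n"
  by (induct n) (simp_all add: eval_form_mult)

lemma eval_form_prod: "eval_form (\<Prod>i\<in>I. f i) x = (\<Prod>i\<in>I. eval_form (f i) x)"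
  by (induct I rule: infinite_finite_induct) (simp_all add: eval_form_mult)

lemma eval_form_const_poly [simp]: "eval_form (const_poly a) x = a"
  by (simp add: const_poly_def eval_form_single)

lemma eval_form_indet [simp]: "eval_form (indet i) x = x $ i"
proof -
  have "(\<Prod>k\<in>UNIV. (x $ k) ^ Poly_Mapping.lookup (Poly_Mapping.single i 1) k)
      = (\<Prod>k\<in>UNIV. if k = i then x $ k else 1)"
    by (intro prod.cong) (auto simp: lookup_single when_def)
  then show ?thesis
    by (simp add: indet_def eval_form_single)
qed

text \<open>Substituting linear forms is precomposition with the matrix. This lets rank and weights
  be discussed for functions on vectors instead of formal polynomials.\<close>

lemma eval_form_coord_change: "eval_form (coord_change M f) x = eval_form f (M *v x)"
  by (simp add: coord_change_def eval_form_sum eval_form_mult eval_form_prod eval_form_power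
      matrix_vector_mult_def)
    (simp add: eval_form_def)

section \<open>Closure properties of homogeneous polynomials\<close>

lemma forms_zero: "0 \<in> forms h"
  by (simp add: forms_def)

lemma forms_add: "f \<in> forms h \<Longrightarrow> g \<in> forms h \<Longrightarrow> f + g \<in> forms h"
  using keys_add[of f g] unfolding forms_def by blast

lemma forms_sum: "(\<And>i. i \<in> I \<Longrightarrow> f i \<in> forms h) \<Longrightarrow> (\<Sum>i\<in>I. f i) \<in> forms h"
  by (induct I rule: infinite_finite_induct) (simp_all add: forms_zero forms_add)

lemma forms_mult:
  assumes "f \<in> forms h" "g \<in> forms k"
  shows "f * g \<in> forms (h + k)"
proof -
  have "(\<Sum>i\<in>UNIV. Poly_Mapping.lookup m i) = h + k" if m: "m \<in> Poly_Mapping.keys (f * g)" for m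
  proof -
    obtain a b where "m = a + b" "a \<in> Poly_Mapping.keys f" "b \<in> Poly_Mapping.keys g"
      using keys_mult[of f g] m by blast
    then show ?thesis
      using assms by (simp add: forms_def lookup_add sum.distrib)
  qed
  then show ?thesis
    by (simp add: forms_def)
qed

lemma forms_const_poly: "const_poly a \<in> forms 0"
  by (simp add: forms_def const_poly_def)

lemma forms_indet: "indet i \<in> forms 1"
proof -
  have "(\<Sum>k\<in>UNIV. Poly_Mapping.lookup (Poly_Mapping.single i (1::nat)) k) =
      (\<Sum>k\<in>UNIV. if k = i then 1 else 0)"
    by (intro sum.cong) (auto simp: lookup_single when_def)
  then show ?thesis
    by (simp add: forms_def indet_def)
qed

lemma forms_const_mult: "f \<in> forms h \<Longrightarrow> const_poly a * f \<in> forms h"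
  using forms_mult[OF forms_const_poly] by fastforce

lemma forms_power: "f \<in> forms h \<Longrightarrow> f ^ n \<in> forms (n * h)"
proof (induct n)
  case 0
  then show ?case by (simp add: forms_def)
next
  case (Suc n)
  then show ?case using forms_mult[of f h "f ^ n" "n * h"] by simp
qed

lemma forms_prod: "finite I \<Longrightarrow> (\<And>i. i \<in> I \<Longrightarrow> f i \<in> forms (h i)) \<Longrightarrow> (\<Prod>i\<in>I. f i) \<in> forms (\<Sum>i\<in>I. h i)"
proof (induct I rule: finite_induct)
  case empty
  then show ?case by (simp add: forms_def)
next
  case (insert i I)
  then show ?case using forms_mult[of "f i" "h i"] by simp
qed

lemma forms_coord_change:
  assumes "f \<in> forms h"
  shows "coord_change M f \<in> forms h"
  unfolding coord_change_def
proof (intro forms_sum forms_const_mult)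
  fix m assume "m \<in> Poly_Mapping.keys f"
  then have deg: "(\<Sum>i\<in>UNIV. Poly_Mapping.lookup m i) = h"
    using assms by (simp add: forms_def)
  have lin: "(\<Sum>j\<in>UNIV. const_poly (M $ i $ j) * indet j) \<in> forms 1" for i
    by (intro forms_sum forms_const_mult forms_indet)
  have "(\<Prod>i\<in>UNIV. (\<Sum>j\<in>UNIV. const_poly (M $ i $ j) * indet j) ^ Poly_Mapping.lookup m i)
      \<in> forms (\<Sum>i\<in>UNIV. Poly_Mapping.lookup m i * 1)"
    by (intro forms_prod forms_power lin) simp
  then show "(\<Prod>i\<in>UNIV. (\<Sum>j\<in>UNIV. const_poly (M $ i $ j) * indet j) ^ Poly_Mapping.lookup m i)
      \<in> forms h"
    using deg by simp
qed

section \<open>Quadratic forms\<close>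

definition quad_monomial :: "5 \<Rightarrow> 5 \<Rightarrow> 5 \<Rightarrow>\<^sub>0 nat" where
  "quad_monomial i j = Poly_Mapping.single i 1 + Poly_Mapping.single j 1"

text \<open>Each monomial of degree 2 is named by exactly one pair, so its coefficient need not be
  split in halves, which would fail in characteristic 2. The explicit list lets sums over it unfold
  by rewriting.\<close>

definition index_pairs :: "(5 \<times> 5) set" where
  "index_pairs = {(0,0),(0,1),(0,2),(0,3),(0,4),(1,1),(1,2),(1,3),(1,4),
    (2,2),(2,3),(2,4),(3,3),(3,4),(4,4)}"

lemma finite_index_pairs [simp]: "finite index_pairs"
  by (simp add: index_pairs_def)

lemma card_index_pairs: "card index_pairs = 15"
  by (simp add: index_pairs_def)

lemma index_pairs_total: "(i, j) \<in> index_pairs \<or> (j, i) \<in> index_pairs"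
  using exhaust_5[of i] exhaust_5[of j] by (elim disjE) (simp_all add: index_pairs_def)

lemma index_pairs_diag: "(i, i) \<in> index_pairs"
  using index_pairs_total by blast

lemma index_pairs_antisym:
  "(i, j) \<in> index_pairs \<Longrightarrow> (j, i) \<in> index_pairs \<Longrightarrow> i = j"
  using exhaust_5[of i] exhaust_5[of j] by (elim disjE) (simp_all add: index_pairs_def)

lemma monomial_split:
  fixes m :: "5 \<Rightarrow>\<^sub>0 nat"
  assumes "(\<Sum>i\<in>UNIV. Poly_Mapping.lookup m i) = Suc n"
  shows "\<exists>i m'. m = Poly_Mapping.single i 1 + m' \<and> (\<Sum>i\<in>UNIV. Poly_Mapping.lookup m' i) = n"
proof -
  obtain i where i: "Poly_Mapping.lookup m i \<noteq> 0"
    using assms by (metis Zero_neq_Suc sum.neutral)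
  define m' where "m' = m - Poly_Mapping.single i 1"
  have m: "m = Poly_Mapping.single i 1 + m'"
    using i by (intro poly_mapping_eqI) (auto simp: m'_def lookup_add lookup_minus lookup_single when_def)
  have "Suc n = (\<Sum>k\<in>UNIV. Poly_Mapping.lookup (Poly_Mapping.single i (1::nat)) k) +
      (\<Sum>k\<in>UNIV. Poly_Mapping.lookup m' k)"
    using assms by (simp add: m lookup_add sum.distrib)
  also have "(\<Sum>k\<in>UNIV. Poly_Mapping.lookup (Poly_Mapping.single i (1::nat)) k) = 1"
    by (simp add: lookup_single when_def)
  finally show ?thesis
    using m by auto
qed

lemma monomial_degree_2:
  fixes m :: "5 \<Rightarrow>\<^sub>0 nat"
  assumes "(\<Sum>i\<in>UNIV. Poly_Mapping.lookup m i) = 2"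
  shows "\<exists>(i, j)\<in>index_pairs. m = quad_monomial i j"
proof -
  obtain i m1 where 1: "m = Poly_Mapping.single i 1 + m1" "(\<Sum>i\<in>UNIV. Poly_Mapping.lookup m1 i) = 1"
    using monomial_split[of m 1] assms by (auto simp: numeral_2_eq_2)
  obtain j m2 where 2: "m1 = Poly_Mapping.single j 1 + m2" "(\<Sum>i\<in>UNIV. Poly_Mapping.lookup m2 i) = 0"
    using monomial_split[of m1 0] 1 by auto
  have "m2 = 0"
    using 2 by (intro poly_mapping_eqI) simp
  then have "m = quad_monomial i j" "m = quad_monomial j i"
    using 1 2 by (simp_all add: quad_monomial_def add.commute)
  then show ?thesis
    using index_pairs_total[of i j] by blast
qed

lemma keys_quad_monomial: "Poly_Mapping.keys (quad_monomial i j) = {i, j}"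
  by (auto simp: quad_monomial_def in_keys_iff lookup_add lookup_single when_def split: if_splits)

lemma inj_on_quad_monomial: "inj_on (\<lambda>(i, j). quad_monomial i j) index_pairs"
proof (rule inj_onI, clarify)
  fix i j k l
  assume *: "(i, j) \<in> index_pairs" "(k, l) \<in> index_pairs" "quad_monomial i j = quad_monomial k l"
  then have "{i, j} = {k, l}"
    by (metis keys_quad_monomial)
  then show "i = k \<and> j = l"
    using * index_pairs_antisym by (metis doubleton_eq_iff)
qed

lemma sum_lookup_quad_monomial: "(\<Sum>k\<in>UNIV. Poly_Mapping.lookup (quad_monomial i j) k) = 2"
  by (simp add: quad_monomial_def lookup_add lookup_single when_def sum.distrib)

lemma prod_quad_monomial:
  "(\<Prod>k\<in>UNIV. (x $ k) ^ Poly_Mapping.lookup (quad_monomial i j) k) = x $ i * (x $ j :: 'a::field)"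
proof -
  have *: "(\<Prod>k\<in>UNIV. (x $ k) ^ Poly_Mapping.lookup (Poly_Mapping.single i 1) k) = x $ i" for i
    using eval_form_indet[of i x] by (simp add: indet_def eval_form_single)
  show ?thesis
    unfolding quad_monomial_def lookup_add power_add prod.distrib * ..
qed

definition quad_coeff :: "'a::field poly5 \<Rightarrow> 5 \<Rightarrow> 5 \<Rightarrow> 'a" where
  "quad_coeff f i j = Poly_Mapping.lookup f (quad_monomial i j)"

lemma keys_forms_2: "f \<in> forms 2 \<Longrightarrow> Poly_Mapping.keys f \<subseteq> (\<lambda>(i, j). quad_monomial i j) ` index_pairs"
  using monomial_degree_2 by (fastforce simp: forms_def)

lemma eval_quadratic_form:
  assumes "f \<in> forms 2"
  shows "eval_form f x = (\<Sum>(i, j)\<in>index_pairs. quad_coeff f i j * x $ i * x $ j)"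
proof -
  have "eval_form f x = (\<Sum>m\<in>(\<lambda>(i, j). quad_monomial i j) ` index_pairs.
      Poly_Mapping.lookup f m * (\<Prod>k\<in>UNIV. (x $ k) ^ Poly_Mapping.lookup m k))"
    using keys_forms_2[OF assms] by (intro eval_form_superset) auto
  also have "\<dots> = (\<Sum>(i, j)\<in>index_pairs. quad_coeff f i j * x $ i * x $ j)"
    by (subst sum.reindex[OF inj_on_quad_monomial])
      (simp add: case_prod_unfold prod_quad_monomial quad_coeff_def mult.assoc)
  finally show ?thesis .
qed

lemma quadratic_form_eqI:
  assumes "f \<in> forms 2" "g \<in> forms 2" "\<And>i j. (i, j) \<in> index_pairs \<Longrightarrow> quad_coeff f i j = quad_coeff g i j"
  shows "f = g"
proof (rule poly_mapping_eqI)
  fix m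
  show "Poly_Mapping.lookup f m = Poly_Mapping.lookup g m"
  proof (cases "m \<in> Poly_Mapping.keys f \<union> Poly_Mapping.keys g")
    case True
    then have "m \<in> (\<lambda>(i, j). quad_monomial i j) ` index_pairs"
      using keys_forms_2[OF assms(1)] keys_forms_2[OF assms(2)] by blast
    then obtain i j where "(i, j) \<in> index_pairs" "m = quad_monomial i j"
      by auto
    then show ?thesis
      using assms(3) by (simp add: quad_coeff_def)
  next
    case False
    then show ?thesis by (simp add: in_keys_iff)
  qed
qed

lemma quadratic_form_exists:
  fixes a :: "5 \<Rightarrow> 5 \<Rightarrow> 'a::field"
  shows "\<exists>f\<in>forms 2. \<forall>(i, j)\<in>index_pairs. quad_coeff f i j = a i j"
proof -
  define f where "f = (\<Sum>(i, j)\<in>index_pairs. Poly_Mapping.single (quad_monomial i j) (a i j))"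
  have "f \<in> forms 2"
    unfolding f_def by (intro forms_sum) (auto simp: forms_def sum_lookup_quad_monomial split: if_splits)
  moreover have "quad_coeff f k l = a k l" if kl: "(k, l) \<in> index_pairs" for k l
  proof -
    have "quad_coeff f k l = (\<Sum>p\<in>index_pairs. if p = (k, l) then a k l else 0)"
      unfolding quad_coeff_def f_def lookup_sum
    proof (rule sum.cong)
      fix p assume p: "p \<in> index_pairs"
      obtain i j where ij: "p = (i, j)" by fastforce
      show "Poly_Mapping.lookup (case p of (i, j) \<Rightarrow> Poly_Mapping.single (quad_monomial i j) (a i j))
          (quad_monomial k l) = (if p = (k, l) then a k l else 0)"
        using inj_onD[OF inj_on_quad_monomial _ p kl] by (auto simp: ij lookup_single when_def)
    qed simp
    then show ?thesis
      using kl by simp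
  qed
  ultimately show ?thesis by blast
qed

text \<open>A form is a free choice of 15 coefficients. The count is one half of the dimension
  computation for the code, the other being the size of the fibres of the evaluation map.\<close>

lemma card_forms_2: "card (forms 2 :: 'a::{field,finite} poly5 set) = CARD('a) ^ 15"
proof -
  let ?c = "\<lambda>f::'a poly5. restrict (\<lambda>(i, j). quad_coeff f i j) index_pairs"
  have "bij_betw ?c (forms 2) (PiE index_pairs (\<lambda>_. UNIV))"
  proof (rule bij_betwI')
    fix f g :: "'a poly5" assume fg: "f \<in> forms 2" "g \<in> forms 2"
    show "?c f = ?c g \<longleftrightarrow> f = g"
    proof
      assume eq: "?c f = ?c g"
      show "f = g"
      proof (rule quadratic_form_eqI[OF fg])
        fix i j assume "(i, j) \<in> index_pairs"
        then show "quad_coeff f i j = quad_coeff g i j"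
          using fun_cong[OF eq, of "(i, j)"] by simp
      qed
    qed simp
  next
    fix a :: "5 \<times> 5 \<Rightarrow> 'a" assume a: "a \<in> PiE index_pairs (\<lambda>_. UNIV)"
    obtain f :: "'a poly5" where "f \<in> forms 2" "\<forall>(i, j)\<in>index_pairs. quad_coeff f i j = a (i, j)"
      using quadratic_form_exists[of "\<lambda>i j. a (i, j)"] by blast
    then show "\<exists>f\<in>forms 2. a = ?c f"
      using a by (intro bexI[of _ f]) (fastforce intro!: ext simp: PiE_def extensional_def)+
  qed auto
  then show ?thesis
    by (simp add: bij_betw_same_card card_PiE card_index_pairs)
qed

subsection \<open>The polar form and the radical\<close>

text \<open>The assumptions say that \<open>Q\<close> is homogeneous of degree 2 and that its polar
  form is linear on the left. They are written out in terms of \<open>Q\<close> because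
  \<open>polar\<close> is defined only inside the locale; linearity on the right follows by
  symmetry. Nothing depends on the characteristic.\<close>

locale quadratic_map =
  fixes Q :: "'a::field ^ 'n \<Rightarrow> 'a"
  assumes scale: "Q (a *s x) = a\<^sup>2 * Q x"
    and polar_add_left: "Q (x + y + z) - Q (x + y) - Q z = (Q (x + z) - Q x - Q z) + (Q (y + z) - Q y - Q z)"
    and polar_scale_left: "Q (a *s x + z) - Q (a *s x) - Q z = a * (Q (x + z) - Q x - Q z)"
begin

definition polar :: "'a ^ 'n \<Rightarrow> 'a ^ 'n \<Rightarrow> 'a" where
  "polar x y = Q (x + y) - Q x - Q y"

text \<open>The condition \<open>Q v = 0\<close> matters in characteristic 2: there the polar form
  of x0 x1 + c x2^2 also vanishes identically on the x2-axis (the nucleus of the conic), although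
  \<open>Q\<close> does not vanish on it when c is nonzero.\<close>

definition radical :: "('a ^ 'n) set" where
  "radical = {v. Q v = 0 \<and> (\<forall>x. polar v x = 0)}"

lemma polar_commute: "polar x y = polar y x"
  by (simp add: polar_def add.commute)

lemma polar_add [simp]: "polar (x + y) z = polar x z + polar y z" "polar z (x + y) = polar z x + polar z y"
  using polar_add_left[where x = x and y = y and z = z]
  by (simp_all add: polar_commute[of z]) (simp_all add: polar_def)

lemma polar_scale [simp]: "polar (a *s x) z = a * polar x z" "polar z (a *s x) = a * polar z x"
  using polar_scale_left[where a = a and x = x and z = z]
  by (simp_all add: polar_commute[of z]) (simp_all add: polar_def)

lemma polar_zero [simp]: "polar 0 x = 0" "polar x 0 = 0"
  using polar_scale(1)[where a = 0 and x = 0 and z = x] by (simp_all add: polar_commute[of x])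

lemma polar_minus [simp]: "polar (- x) z = - polar x z" "polar z (- x) = - polar z x"
  using polar_scale[where a = "-1" and x = x and z = z] by simp_all

lemma polar_diff [simp]: "polar (x - y) z = polar x z - polar y z" "polar z (x - y) = polar z x - polar z y"
  using polar_add[where x = x and y = "- y" and z = z] by simp_all

lemma Q_add: "Q (x + y) = Q x + Q y + polar x y"
  by (simp add: polar_def)

lemma Q_zero [simp]: "Q 0 = 0"
  using scale[of 0 0] by simp

lemma polar_self: "polar x x = 2 * Q x"
proof -
  have "Q (x + x) = Q ((1 + 1) *s x)" by (simp only: vec.scale_left_distrib vec.scale_one)
  then have "Q (x + x) = (1 + 1)\<^sup>2 * Q x" by (simp only: scale)
  then show ?thesis by (simp add: polar_def power2_eq_square algebra_simps)
qed

lemma radicalD: "v \<in> radical \<Longrightarrow> Q v = 0" "v \<in> radical \<Longrightarrow> polar v x = 0" "v \<in> radical \<Longrightarrow> polar x v = 0"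
  by (simp_all add: radical_def polar_commute[of x])

lemma subspace_radical: "vec.subspace radical"
  by (auto simp: vec.subspace_def radical_def Q_add scale)

lemma radicalI:
  assumes "\<And>x. Q (x + v) = Q x"
  shows "v \<in> radical"
proof -
  have "Q v = 0" using assms[of 0] by simp
  moreover have "polar v x = 0" for x
    using assms[of x] \<open>Q v = 0\<close> by (simp add: polar_def add.commute)
  ultimately show ?thesis by (simp add: radical_def)
qed

end

lemma quadratic_map_eval_form:
  assumes f: "f \<in> forms 2"
  shows "quadratic_map (eval_form f)"
proof
  have polar: "eval_form f (x + y) - eval_form f x - eval_form f y =
      (\<Sum>(i, j)\<in>index_pairs. quad_coeff f i j * (x $ i * y $ j + x $ j * y $ i))" for x y
    by (simp add: eval_quadratic_form[OF f] case_prod_unfold algebra_simps flip: sum_subtractf)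
  fix a x y z
  show "eval_form f (a *s x) = a\<^sup>2 * eval_form f x"
    by (rule eval_form_scale[OF f])
  show "eval_form f (x + y + z) - eval_form f (x + y) - eval_form f z =
      (eval_form f (x + z) - eval_form f x - eval_form f z) +
      (eval_form f (y + z) - eval_form f y - eval_form f z)"
    unfolding polar sum.distrib[symmetric] by (intro sum.cong) (auto simp: algebra_simps)
  show "eval_form f (a *s x + z) - eval_form f (a *s x) - eval_form f z =
      a * (eval_form f (x + z) - eval_form f x - eval_form f z)"
    unfolding polar sum_distrib_left by (intro sum.cong) (auto simp: algebra_simps)
qed

lemma quad_coeff_diag:
  assumes "f \<in> forms 2"
  shows "quad_coeff f i i = eval_form f (axis i 1)"
proof -
  have "eval_form f (axis i 1) = (\<Sum>p\<in>index_pairs. if p = (i, i) then quad_coeff f i i else 0)"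
    unfolding eval_quadratic_form[OF assms] by (intro sum.cong) (auto simp: axis_def split: if_splits)
  then show ?thesis
    by (simp add: index_pairs_diag)
qed

text \<open>The mixed coefficient is the polar form at two basis vectors. Together with the diagonal
  case this recovers all coefficients from values at 0/1-vectors, hence over every field.\<close>

lemma quad_coeff_off_diag:
  assumes "f \<in> forms 2" "(i, j) \<in> index_pairs" "i \<noteq> j"
  shows "quad_coeff f i j = eval_form f (axis i 1 + axis j 1) - eval_form f (axis i 1) - eval_form f (axis j 1)"
proof -
  have "eval_form f (axis i 1 + axis j 1) = (\<Sum>p\<in>index_pairs. (if p = (i, i) then quad_coeff f i i else 0) +
      (if p = (j, j) then quad_coeff f j j else 0) + (if p = (i, j) then quad_coeff f i j else 0))"
    unfolding eval_quadratic_form[OF assms(1)]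
    using assms index_pairs_antisym by (intro sum.cong) (auto simp: axis_def split: if_splits)
  then show ?thesis
    using assms by (simp add: sum.distrib index_pairs_diag quad_coeff_diag)
qed

text \<open>Over the field with two elements this fails for inhomogeneous polynomials of degree 2.\<close>
lemma quadratic_form_eq_iff_eval:
  assumes "f \<in> forms 2" "g \<in> forms 2"
  shows "f = g \<longleftrightarrow> eval_form f = eval_form g"
proof
  assume eq: "eval_form f = eval_form g"
  show "f = g"
  proof (rule quadratic_form_eqI[OF assms])
    fix i j assume "(i, j) \<in> index_pairs"
    then show "quad_coeff f i j = quad_coeff g i j"
      using assms eq by (cases "i = j") (simp_all add: quad_coeff_diag quad_coeff_off_diag)
  qed
qed simp

section \<open>Rank and normal forms\<close>

context quadratic_map
begin

text \<open>On \<open>S\<close> the functional \<open>polar p\<close> has a kernel of codimension at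
  most one: any \<open>u\<close> in \<open>S\<close> outside the kernel spans \<open>S\<close>
  together with it.\<close>

lemma dim_orthogonal:
  assumes "vec.subspace S"
  shows "vec.dim S \<le> Suc (vec.dim (S \<inter> {x. polar p x = 0}))" (is "_ \<le> Suc (vec.dim ?T)")
proof (cases "\<forall>x\<in>S. polar p x = 0")
  case True
  then have "?T = S" by blast
  then show ?thesis by simp
next
  case False
  then obtain u where u: "u \<in> S" "polar p u \<noteq> 0" by blast
  have "S \<subseteq> vec.span (insert u ?T)"
  proof
    fix x assume "x \<in> S"
    let ?k = "polar p x / polar p u"
    have "x - ?k *s u \<in> vec.span ?T"
      using u \<open>x \<in> S\<close> assms by (intro vec.span_base) (simp add: vec.subspace_diff vec.subspace_scale)
    then show "x \<in> vec.span (insert u ?T)"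
      unfolding vec.span_breakdown_eq by blast
  qed
  then have "vec.dim S \<le> vec.dim (insert u ?T)"
    by (metis vec.dim_span vec.dim_subset)
  also have "\<dots> \<le> Suc (vec.dim ?T)"
    by (simp add: vec.dim_insert)
  finally show ?thesis .
qed

lemma subspace_orthogonal: "vec.subspace {x. polar p x = 0}"
  by (auto simp: vec.subspace_def)

lemma not_radical_obtain:
  assumes "p \<notin> radical" "Q p = 0"
  obtains u where "polar p u \<noteq> 0"
  using assms by (auto simp: radical_def)

text \<open>After scaling \<open>u\<close> to a vector \<open>v\<close> with
  \<open>polar p v = 1\<close>, adding a multiple of the singular vector \<open>p\<close> changes
  \<open>Q v\<close> by exactly that multiple and leaves the pairing with \<open>p\<close>
  unchanged, so the value can be cancelled.\<close>

lemma hyperbolic_partner: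
  assumes "Q p = 0" "polar p u \<noteq> 0"
  shows "\<exists>a b. Q (a *s u + b *s p) = 0 \<and> polar p (a *s u + b *s p) = 1"
proof -
  define v where "v = inverse (polar p u) *s u"
  have v: "polar p v = 1" "polar v p = 1"
    using assms(2) by (simp_all add: v_def polar_commute[of u p])
  have "Q (v + b *s p) = Q v + b" "polar p (v + b *s p) = 1" for b
    using v assms(1) by (simp_all add: Q_add scale polar_self)
  from this[of "- Q v"] show ?thesis
    unfolding v_def by (metis add.right_inverse)
qed

end

section \<open>Singular vectors over finite fields\<close>

lemma vec_dim_less_imp_exists: "vec.dim B < vec.dim A \<Longrightarrow> \<exists>x\<in>A. x \<notin> B"
  using vec.dim_subset[of A B] by force

text \<open>A nonzero square has at most two roots and 0 has only one. The single root of 0 makes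
  the inequality strict, which the pigeonhole argument for sums of two squares requires.\<close>

lemma card_squares:
  "CARD('a::{field,finite}) < 2 * card (range (\<lambda>x::'a. x\<^sup>2))"
proof -
  let ?S = "range (\<lambda>x::'a. x\<^sup>2)"
  have "CARD('a) = card (\<Union>y\<in>?S. {x. x\<^sup>2 = y})"
    by (rule arg_cong[of _ _ card]) auto
  also have "\<dots> \<le> (\<Sum>y\<in>?S. card {x::'a. x\<^sup>2 = y})"
    by (rule card_UN_le) simp
  also have "\<dots> = card {x::'a. x\<^sup>2 = 0} + (\<Sum>y\<in>?S - {0}. card {x::'a. x\<^sup>2 = y})"
    by (rule sum.remove) (auto intro: image_eqI[of _ _ 0])
  also have "\<dots> \<le> 1 + (\<Sum>y\<in>?S - {0}. 2)"
  proof (intro add_mono sum_mono)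
    fix y assume "y \<in> ?S - {0}"
    then obtain z where "y = z\<^sup>2" by blast
    then have "{x. x\<^sup>2 = y} \<subseteq> {z, - z}"
      by (auto simp: power2_eq_iff)
    then have "card {x. x\<^sup>2 = y} \<le> card {z, - z}"
      by (intro card_mono) auto
    then show "card {x. x\<^sup>2 = y} \<le> 2"
      using card_insert_le_m1[of 2 "{-z}" z] by simp
  qed simp
  also have "\<dots> < 2 * card ?S"
  proof -
    have "(0::'a) \<in> ?S" by (auto intro: image_eqI[of _ _ 0])
    then have "card (?S - {0}) < card ?S"
      by (intro card_Diff1_less) auto
    then show ?thesis by simp
  qed
  finally show ?thesis .
qed

text \<open>The values of \<open>a * s^2\<close> and those of \<open>c - b * t^2\<close> each fill
  more than half of the field, so the two sets meet.\<close>

lemma sum_of_squares_represents: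
  fixes a b c :: "'a::{field,finite}"
  assumes "a \<noteq> 0" "b \<noteq> 0"
  shows "\<exists>s t. a * s\<^sup>2 + b * t\<^sup>2 = c"
proof (rule ccontr)
  assume *: "\<not> ?thesis"
  let ?S = "range (\<lambda>x::'a. x\<^sup>2)"
  have "card ((\<lambda>y. a * y) ` ?S) = card ?S" "card ((\<lambda>y. c - b * y) ` ?S) = card ?S"
    using assms by (auto intro!: card_image inj_onI)
  moreover have "((\<lambda>y. a * y) ` ?S) \<inter> ((\<lambda>y. c - b * y) ` ?S) = {}"
    using * by (auto simp: algebra_simps)
  ultimately have "2 * card ?S = card ((\<lambda>y. a * y) ` ?S \<union> (\<lambda>y. c - b * y) ` ?S)"
    by (simp add: card_Un_disjoint)
  also have "\<dots> \<le> CARD('a)"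
    by (intro card_mono) auto
  finally show False
    using card_squares[where 'a='a] by simp
qed

text \<open>Squaring is injective since \<open>- y = y\<close>, hence surjective on a finite
  field.\<close>

lemma square_root_char_2:
  fixes c :: "'a::{field,finite}"
  assumes "(2::'a) = 0"
  shows "\<exists>s. s\<^sup>2 = c"
proof -
  have "x = y" if "x\<^sup>2 = y\<^sup>2" for x y :: 'a
  proof -
    have "x = y \<or> x = - y" using that by (simp add: power2_eq_iff)
    moreover have "- y = y" using assms by (metis add_eq_0_iff mult_2 mult_zero_left)
    ultimately show ?thesis by auto
  qed
  then have "inj (\<lambda>x::'a. x\<^sup>2)" by (rule injI)
  then have "surj (\<lambda>x::'a. x\<^sup>2)" by (simp add: finite_UNIV_inj_surj)
  then show ?thesis by (metis surjD)
qed

text \<open>Over a finite field an anisotropic form has at most two variables; this is the version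
  modulo the radical. If all singular vectors were radical, orthogonal vectors outside the radical
  could be combined into a singular vector that contradicts their choice. Characteristic 2 needs two
  such vectors, odd characteristic three.\<close>

lemma exists_singular_vector:
  fixes Q :: "'a::{field,finite} ^ 'n \<Rightarrow> 'a"
  assumes Q: "quadratic_map Q" and dim: "vec.dim (quadratic_map.radical Q) + 3 \<le> CARD('n)"
  shows "\<exists>p. Q p = 0 \<and> p \<notin> quadratic_map.radical Q"
proof (rule ccontr)
  interpret quadratic_map Q by fact
  assume "\<not> ?thesis"
  then have anis: "p \<in> radical" if "Q p = 0" for p
    using that by blast
  have n: "vec.dim (UNIV :: ('a ^ 'n) set) = CARD('n)"
    by (simp add: card_cart_basis)
  have "vec.dim radical < vec.dim (UNIV :: ('a ^ 'n) set)"
    using dim n by linarith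
  then obtain a where a: "a \<notin> radical"
    using vec_dim_less_imp_exists by blast
  have Qa: "Q a \<noteq> 0"
    using a anis by blast
  have dim_a: "CARD('n) \<le> Suc (vec.dim {x. polar a x = 0})"
    using dim_orthogonal[OF vec.subspace_UNIV, of a] n by simp
  show False
  proof (cases "(2::'a) = 0")
    case True
    \<comment> \<open>Here \<open>a\<close> is orthogonal to itself, so \<open>b\<close> must be
      chosen outside the span of \<open>a\<close> and the radical, not merely outside the radical.
      The three spare dimensions leave room for this.\<close>
    have "vec.dim (vec.span (insert a radical)) \<le> Suc (vec.dim radical)"
      by (simp add: vec.dim_insert)
    then have "vec.dim (vec.span (insert a radical)) < vec.dim {x. polar a x = 0}"
      using dim dim_a by linarith
    then obtain b where b: "polar a b = 0" "b \<notin> vec.span (insert a radical)"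
      using vec_dim_less_imp_exists by blast
    obtain s where "s\<^sup>2 = - Q b / Q a"
      using square_root_char_2[OF True] by blast
    then have "Q (b + s *s a) = 0"
      using Qa b by (simp add: Q_add scale polar_commute[of b])
    then have "b + s *s a \<in> radical" by (rule anis)
    then have "b + s *s a \<in> vec.span (insert a radical)"
      by (simp add: vec.span_base)
    moreover have "s *s a \<in> vec.span (insert a radical)"
      by (simp add: vec.span_base vec.span_scale)
    ultimately have "b \<in> vec.span (insert a radical)"
      by (metis add_diff_cancel_right' vec.span_diff)
    then show False using b by blast
  next
    case False
    have "vec.dim radical < vec.dim {x. polar a x = 0}"
      using dim dim_a by linarith
    then obtain b where b: "polar a b = 0" "b \<notin> radical"
      using vec_dim_less_imp_exists by blast
    have "vec.dim {x. polar a x = 0} \<le> Suc (vec.dim ({x. polar a x = 0} \<inter> {x. polar b x = 0}))"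
      by (rule dim_orthogonal[OF subspace_orthogonal])
    then have "vec.dim radical < vec.dim ({x. polar a x = 0} \<inter> {x. polar b x = 0})"
      using dim dim_a by linarith
    then obtain c where c: "polar a c = 0" "polar b c = 0" "c \<notin> radical"
      using vec_dim_less_imp_exists by blast
    have Qb: "Q b \<noteq> 0"
      using b anis by blast
    obtain s t where st: "Q a * s\<^sup>2 + Q b * t\<^sup>2 = - Q c"
      using sum_of_squares_represents[OF Qa Qb] by blast
    \<comment> \<open>Pairing \<open>p\<close> with \<open>a\<close> and \<open>b\<close> gives
      \<open>2 * s * Q a\<close> and \<open>2 * t * Q b\<close>. If \<open>p\<close> is radical,
      both \<open>s\<close> and \<open>t\<close> vanish and \<open>p\<close> is the non-radical
      vector \<open>c\<close>.\<close>
    define p where "p = s *s a + t *s b + c"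
    have "Q p = (Q a * s\<^sup>2 + Q b * t\<^sup>2) + Q c"
      using b c by (simp add: p_def mult.commute Q_add scale polar_commute[of c a] polar_commute[of c b] polar_commute[of b a])
    then have p: "p \<in> radical"
      using anis st by simp
    have "polar a p = s * (2 * Q a)" "polar b p = t * (2 * Q b)"
      using b c by (simp_all add: p_def polar_self polar_commute[of b a])
    then have "s = 0" "t = 0"
      using radicalD(3)[OF p] Qa Qb False by simp_all
    then show False
      using p c by (simp add: p_def)
  qed
qed

section \<open>Adapted bases and normal forms\<close>

lemma matrix_of_columns_mult:
  fixes h :: "'n::finite \<Rightarrow> 'a::field ^ 'n"
  shows "(\<chi> i j. h j $ i) *v z = (\<Sum>j\<in>UNIV. z $ j *s h j)"
  by (simp add: vec_eq_iff matrix_vector_mult_def mult.commute)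

lemma invertible_of_columns:
  fixes h :: "'n::finite \<Rightarrow> 'a::field ^ 'n"
  assumes "\<And>z. (\<Sum>j\<in>UNIV. z $ j *s h j) = 0 \<Longrightarrow> z = 0"
  shows "invertible (\<chi> i j. h j $ i)"
  unfolding invertible_left_inverse matrix_left_invertible_ker matrix_of_columns_mult
  using assms by blast

lemma invertible_surj:
  assumes "invertible M"
  shows "\<exists>y. x = M *v (y :: 'a::field ^ 'n)"
proof -
  obtain N where "M ** N = mat 1"
    using assms invertible_def by blast
  then have "x = M *v (N *v x)"
    by (simp add: matrix_vector_mul_assoc)
  then show ?thesis ..
qed

lemma invertible_inj:
  assumes "invertible M" "M *v x = M *v y"
  shows "x = (y :: 'a::field ^ 'n)"
proof -
  obtain N where N: "N ** M = mat 1"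
    using assms(1) invertible_def by blast
  have "N *v (M *v x) = N *v (M *v y)"
    using assms(2) by simp
  then show ?thesis
    by (simp add: matrix_vector_mul_assoc N)
qed

text \<open>The columns of \<open>M\<close> are a hyperbolic pair \<open>p\<close>,
  \<open>w\<close>, a vector \<open>z\<close> orthogonal to both, and a basis of the radical. The
  coefficient \<open>c\<close> is \<open>Q z\<close>.\<close>

lemma conic_cone_normal_form:
  fixes Q :: "'a::{field,finite} ^ 5 \<Rightarrow> 'a"
  assumes Q: "quadratic_map Q" and dim: "vec.dim (quadratic_map.radical Q) = 2"
  shows "\<exists>M c. invertible M \<and> c \<noteq> 0 \<and> (\<forall>z :: 'a ^ 5. Q (M *v z) = z $ 0 * z $ 1 + c * (z $ 2)\<^sup>2)"
proof -
  interpret quadratic_map Q by fact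
  obtain p where p: "Q p = 0" "p \<notin> radical"
    using exists_singular_vector[OF Q] dim by auto
  obtain u where u: "polar p u \<noteq> 0"
    using not_radical_obtain[OF p(2,1)] .
  obtain w where w: "Q w = 0" "polar p w = 1"
    using hyperbolic_partner[OF p(1) u] by blast
  have wp: "polar w p = 1" using w by (simp add: polar_commute)
  have "vec.dim (UNIV :: ('a ^ 5) set) = 5"
    by (simp add: card_cart_basis)
  \<comment> \<open>Two orthogonality conditions leave dimension at least 3, one more than the
    radical.\<close>
  then have "vec.dim radical < vec.dim ({x. polar p x = 0} \<inter> {x. polar w x = 0})"
    using dim dim_orthogonal[OF vec.subspace_UNIV, of p]
      dim_orthogonal[OF subspace_orthogonal[of p], of w] by simp
  then obtain z where z: "polar p z = 0" "polar w z = 0" "z \<notin> radical"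
    using vec_dim_less_imp_exists by blast
  obtain B where B: "B \<subseteq> radical" "vec.independent B" "card B = 2"
    using vec.basis_exists[of radical] dim by metis
  then obtain k l where kl: "B = {k, l}" "k \<noteq> l"
    by (auto simp: card_2_iff)
  have k: "k \<in> radical" and l: "l \<in> radical"
    using B kl by auto
  define h :: "5 \<Rightarrow> 'a ^ 5" where
    "h i = (if i = 0 then p else if i = 1 then w else if i = 2 then z else if i = 3 then k else l)" for i
  define M where "M = (\<chi> i j. h j $ i)"
  have Mz: "M *v x = x $ 0 *s p + x $ 1 *s w + x $ 2 *s z + x $ 3 *s k + x $ 4 *s l" for x
    unfolding M_def matrix_of_columns_mult sum_5 by (simp add: h_def)
  have zero: "x = 0" if x0: "M *v x = 0" for x
  proof -
    have "polar w (M *v x) = x $ 0" "polar p (M *v x) = x $ 1"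
      using w wp z p k l by (simp_all add: Mz polar_self radicalD(3))
    then have 01: "x $ 0 = 0" "x $ 1 = 0"
      using x0 by simp_all
    then have eq: "x $ 2 *s z + x $ 3 *s k + x $ 4 *s l = 0"
      using x0 by (simp add: Mz)
    have 2: "x $ 2 = 0"
    proof (rule ccontr)
      assume "x $ 2 \<noteq> 0"
      have "x $ 2 *s z = - (x $ 3 *s k + x $ 4 *s l)"
        using eq unfolding eq_neg_iff_add_eq_0 by (simp add: add.assoc)
      also have "\<dots> \<in> radical"
        using k l subspace_radical by (simp add: vec.subspace_neg vec.subspace_diff vec.subspace_scale)
      finally have "inverse (x $ 2) *s (x $ 2 *s z) \<in> radical"
        using subspace_radical vec.subspace_scale by blast
      then show False
        using \<open>x $ 2 \<noteq> 0\<close> z by (simp add: vec.scale_scale)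
    qed
    have "x $ 3 *s k + x $ 4 *s l = 0"
      using eq 2 by simp
    then have sum0: "(\<Sum>v\<in>{k, l}. (if v = k then x $ 3 else x $ 4) *s v) = 0"
      using kl by simp
    have "vec.independent {k, l}" using B kl by simp
    then have "(if v = k then x $ 3 else x $ 4) = 0" if "v \<in> {k, l}" for v
      using vec.independentD[OF _ _ subset_refl sum0 that] by simp
    from this[of k] this[of l] have "x $ 3 = 0" "x $ 4 = 0"
      using kl by auto
    then show "x = 0"
      using 01 2 by (auto simp: vec_eq_iff) (metis exhaust_5)
  qed
  have inv: "invertible M"
    unfolding M_def by (rule invertible_of_columns) (use zero in \<open>simp add: M_def matrix_of_columns_mult\<close>)
  have form: "Q (M *v x) = x $ 0 * x $ 1 + Q z * (x $ 2)\<^sup>2" for x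
    using w wp z p k l by (simp add: Mz Q_add scale radicalD)
  \<comment> \<open>Otherwise \<open>z\<close> would be singular and orthogonal to every column of
    \<open>M\<close>, to itself because \<open>polar z z = 2 * Q z\<close>, and thus
    radical.\<close>
  have "Q z \<noteq> 0"
  proof
    assume Qz: "Q z = 0"
    have "polar z x = 0" for x
    proof -
      obtain y where "x = M *v y" using invertible_surj[OF inv] by blast
      then show ?thesis
        using z k l Qz by (simp add: Mz polar_self radicalD polar_commute[of z p] polar_commute[of z w])
    qed
    then show False
      using z Qz by (simp add: radical_def)
  qed
  then show ?thesis
    using inv form by blast
qed

text \<open>The totally singular space \<open>W\<close> supplies two orthogonal singular vectors
  outside the radical, each of which gets a hyperbolic partner. It is \<open>W\<close> that excludes
  the elliptic type, for which no second such pair can be split off.\<close>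

lemma hyperbolic_cone_normal_form:
  fixes Q :: "'a::field ^ 5 \<Rightarrow> 'a"
  assumes Q: "quadratic_map Q" and dim: "vec.dim (quadratic_map.radical Q) = 1"
    and W: "vec.subspace W" "vec.dim W = 3" "\<And>x. x \<in> W \<Longrightarrow> Q x = 0"
  shows "\<exists>M. invertible M \<and> (\<forall>z :: 'a ^ 5. Q (M *v z) = z $ 0 * z $ 1 - z $ 2 * z $ 3)"
proof -
  interpret quadratic_map Q by fact
  have polar_W: "polar x y = 0" if "x \<in> W" "y \<in> W" for x y
    using that W by (simp add: polar_def vec.subspace_add)
  have "vec.dim radical < vec.dim W"
    using dim W by simp
  then obtain p where p: "p \<in> W" "p \<notin> radical"
    using vec_dim_less_imp_exists by blast
  have Qp: "Q p = 0" using W p by blast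
  obtain u where u: "polar p u \<noteq> 0"
    using not_radical_obtain[OF p(2) Qp] .
  obtain w where w: "Q w = 0" "polar p w = 1"
    using hyperbolic_partner[OF Qp u] by blast
  have wp: "polar w p = 1" using w by (simp add: polar_commute)
  \<comment> \<open>Orthogonality to \<open>w\<close> costs at most one of the three dimensions of
    \<open>W\<close>, leaving 2 against 1 for the radical.\<close>
  have "vec.dim radical < vec.dim (W \<inter> {x. polar w x = 0})"
    using dim W dim_orthogonal[OF W(1), of w] by simp
  then obtain p' where p': "p' \<in> W" "polar w p' = 0" "p' \<notin> radical"
    using vec_dim_less_imp_exists by blast
  have Qp': "Q p' = 0" and pp': "polar p p' = 0" "polar p' p = 0" and wp': "polar p' w = 0"
    using W p p' polar_W by (auto simp: polar_commute[of p' w])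
  obtain u where u: "polar p' u \<noteq> 0"
    using not_radical_obtain[OF p'(3) Qp'] .
  \<comment> \<open>The projection of \<open>u\<close> to the orthogonal complement of the
    hyperbolic pair \<open>p\<close>, \<open>w\<close>; the pairing with \<open>p'\<close> survives
    because \<open>p'\<close> is orthogonal to both.\<close>
  define u' where "u' = u - polar w u *s p - polar p u *s w"
  have u': "polar p u' = 0" "polar w u' = 0" "polar p' u' \<noteq> 0"
    using w wp pp' wp' p' u Qp by (simp_all add: u'_def polar_self)
  obtain a b where ab: "Q (a *s u' + b *s p') = 0" "polar p' (a *s u' + b *s p') = 1"
    using hyperbolic_partner[OF Qp' u'(3)] by blast
  \<comment> \<open>The sign turns the second hyperbolic plane into - x2 x3, so that the normal form
    is a determinant whose planes have a parametrization without signs.\<close>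
  define w' where "w' = - (a *s u' + b *s p')"
  have Qw': "Q w' = 0"
    using ab(1) scale[of "-1" "a *s u' + b *s p'"] by (simp only: w'_def vec.scale_minus_left vec.scale_one) simp
  have w': "polar p' w' = -1" "polar p w' = 0" "polar w w' = 0"
    using ab(2) u' pp' p' unfolding w'_def by (simp_all only: polar_minus) simp_all
  have w'': "polar w' p' = -1" "polar w' p = 0" "polar w' w = 0"
    using w' by (simp_all add: polar_commute[of w'])
  obtain B where B: "B \<subseteq> radical" "vec.independent B" "card B = 1"
    using vec.basis_exists[of radical] dim by metis
  then obtain k where kB: "B = {k}"
    by (auto simp: card_1_singleton_iff)
  have k: "k \<in> radical" "k \<noteq> 0"
    using B kB by auto
  define h :: "5 \<Rightarrow> 'a ^ 5" where
    "h i = (if i = 0 then p else if i = 1 then w else if i = 2 then p' else if i = 3 then w' else k)" for i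
  define M where "M = (\<chi> i j. h j $ i)"
  have Mz: "M *v x = x $ 0 *s p + x $ 1 *s w + x $ 2 *s p' + x $ 3 *s w' + x $ 4 *s k" for x
    unfolding M_def matrix_of_columns_mult sum_5 by (simp add: h_def)
  have zero: "x = 0" if x0: "M *v x = 0" for x
  proof -
    have "polar w (M *v x) = x $ 0" "polar p (M *v x) = x $ 1"
        "polar w' (M *v x) = - x $ 2" "polar p' (M *v x) = - x $ 3"
      using w wp pp' wp' p' w' w'' Qw' Qp Qp' k
      by (simp_all add: Mz polar_self radicalD(3))
    then have 0: "x $ 0 = 0" "x $ 1 = 0" "x $ 2 = 0" "x $ 3 = 0"
      using x0 by simp_all
    then have "x $ 4 *s k = 0"
      using x0 by (simp add: Mz)
    then have "x $ 4 = 0"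
      using k by simp
    then show "x = 0"
      using 0 by (auto simp: vec_eq_iff) (metis exhaust_5)
  qed
  have inv: "invertible M"
    unfolding M_def by (rule invertible_of_columns) (use zero in \<open>simp add: M_def matrix_of_columns_mult\<close>)
  have form: "Q (M *v x) = x $ 0 * x $ 1 - x $ 2 * x $ 3" for x
    using w wp pp' wp' p' w' w'' Qw' Qp Qp' k by (simp add: Mz Q_add scale radicalD)
  show ?thesis
    using inv form by blast
qed

section \<open>Rank and dimension of the radical\<close>

lemma form_rank_le: "invertible M \<Longrightarrow> form_rank f \<le> card (indets (coord_change M f))"
  unfolding form_rank_def by (rule Least_le) blast

lemma form_rank_attained: "\<exists>M. invertible M \<and> form_rank f = card (indets (coord_change M f))"
proof -
  have "invertible (mat 1 :: 'a ^ 5 ^ 5)"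
    by (auto simp: invertible_def)
  then show ?thesis
    unfolding form_rank_def by (intro LeastI_ex[where P = "\<lambda>r. \<exists>M. invertible M \<and> r = card (indets (coord_change M f))"]) blast
qed

lemma eval_form_indep:
  assumes "i \<notin> indets f"
  shows "eval_form f (x + a *s axis i 1) = eval_form f x"
  unfolding eval_form_def
proof (intro sum.cong refl arg_cong2[where f = "(*)"] prod.cong)
  fix m k assume "m \<in> Poly_Mapping.keys f"
  then have "Poly_Mapping.lookup m i = 0"
    using assms by (auto simp: indets_def in_keys_iff)
  then show "((x + a *s axis i 1) $ k) ^ Poly_Mapping.lookup m k = (x $ k) ^ Poly_Mapping.lookup m k"
    by (cases "k = i") (simp_all add: axis_def)
qed

text \<open>Each indeterminate missing after a coordinate change contributes a column of the matrix
  to the radical. Conversely, using a basis that extends one of the radical as columns removes one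
  indeterminate per radical vector.\<close>

lemma form_rank_eq:
  fixes f :: "'a::field poly5"
  assumes f: "f \<in> forms 2"
  shows "form_rank f + vec.dim (quadratic_map.radical (eval_form f)) = 5"
proof -
  interpret quadratic_map "eval_form f"
    using f by (rule quadratic_map_eval_form)
  have "5 \<le> form_rank f + vec.dim radical"
  proof -
    obtain M where M: "invertible M" "form_rank f = card (indets (coord_change M f))"
      using form_rank_attained by blast
    let ?I = "indets (coord_change M f)"
    \<comment> \<open>The form does not change under translation along the axis of a missing
      indeterminate.\<close>
    have "M *v axis i 1 \<in> radical" if i: "i \<notin> ?I" for i
    proof (rule radicalI)
      fix x
      obtain y where y: "x = M *v y" using invertible_surj[OF M(1)] by blast
      show "eval_form f (x + M *v axis i 1) = eval_form f x"
        using eval_form_indep[OF i, of y 1]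
        by (simp add: y eval_form_coord_change matrix_vector_right_distrib)
    qed
    then have sub: "(*v) M ` (\<lambda>i. axis i 1) ` (- ?I) \<subseteq> radical"
      by blast
    have "vec.independent ((\<lambda>i. axis i (1::'a)) ` (- ?I))"
      by (rule vec.independent_mono[OF independent_cart_basis]) (auto simp: cart_basis_def)
    moreover have inj: "inj_on ((*v) M) S" for S
      using invertible_inj[OF M(1)] by (blast intro: inj_onI)
    ultimately have "vec.independent ((*v) M ` (\<lambda>i. axis i (1::'a)) ` (- ?I))"
      by (intro vec.linear_independent_injective_image matrix_vector_mul_linear_gen) auto
    then have "card ((*v) M ` (\<lambda>i. axis i (1::'a)) ` (- ?I)) \<le> vec.dim radical"
      using sub by (intro vec.independent_card_le_dim)
    moreover have "card ((*v) M ` (\<lambda>i. axis i (1::'a)) ` (- ?I)) = card (- ?I)"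
      by (simp add: card_image[OF inj] card_image inj_on_def axis_eq_axis)
    moreover have "card (- ?I) + card ?I = 5"
      using card_mono[of UNIV ?I] by (simp add: Compl_eq_Diff_UNIV card_Diff_subset)
    ultimately show ?thesis
      using M by linarith
  qed
  moreover have "form_rank f + vec.dim radical \<le> 5"
  proof -
    obtain B where B: "B \<subseteq> radical" "vec.independent B" "card B = vec.dim radical"
      using vec.basis_exists[of radical] by metis
    obtain C where C: "B \<subseteq> C" "vec.independent C" "UNIV \<subseteq> vec.span C"
      using vec.maximal_independent_subset_extend[of B UNIV] B by auto
    have "card C = vec.dim (UNIV :: ('a ^ 5) set)"
      using vec.basis_card_eq_dim[of C UNIV] C by simp
    then have "card C = card (UNIV :: 5 set)"
      by (simp add: card_cart_basis)
    then obtain h where h: "bij_betw h (UNIV :: 5 set) C"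
      using finite_same_card_bij[of "UNIV :: 5 set" C] vec.finiteI_independent[OF C(2)] by auto
    define J where "J = {i. h i \<in> B}"
    have "h ` J = B"
      using h C(1) by (auto simp: J_def bij_betw_def)
    then have "card J = vec.dim radical"
      using h B(3) by (metis bij_betw_imp_inj_on card_image inj_on_subset top_greatest)
    define M where "M = (\<chi> i j. h j $ i)"
    have "invertible M"
      unfolding M_def
    proof (rule invertible_of_columns)
      fix z assume "(\<Sum>j\<in>UNIV. z $ j *s h j) = 0"
      moreover have "(\<Sum>j\<in>UNIV. z $ j *s h j) = (\<Sum>v\<in>C. z $ (inv h v) *s v)"
        using sum.reindex_bij_betw[OF h, of "\<lambda>v. z $ (inv h v) *s v"] h by (simp add: bij_betw_def)
      ultimately have "(\<Sum>v\<in>C. z $ (inv h v) *s v) = 0"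
        by simp
      then have "z $ (inv h v) = 0" if "v \<in> C" for v
        using vec.independentD[OF C(2) vec.finiteI_independent[OF C(2)] subset_refl,
            of "\<lambda>v. z $ (inv h v)"] that by simp
      then show "z = 0"
        using h by (metis bij_betw_def inv_f_f rangeI vec_eq_iff zero_index)
    qed
    have Maxis: "M *v axis j 1 = h j" for j
      by (simp add: M_def vec_eq_iff matrix_vector_mult_def axis_def if_distrib cong: if_cong)
    have "indets (coord_change M f) \<subseteq> - J"
    proof -
      let ?g = "coord_change M f"
      have g: "?g \<in> forms 2"
        using f by (rule forms_coord_change)
      \<comment> \<open>The coefficients of the transformed form are values of
        \<open>eval_form f\<close> and of \<open>polar\<close> at columns of \<open>M\<close>, and
        both vanish once a radical column is involved.\<close>
      have coeff0: "quad_coeff ?g i j = 0" if ij: "(i, j) \<in> index_pairs" "i \<in> J \<or> j \<in> J" for i j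
      proof -
        have "h i \<in> radical \<or> h j \<in> radical"
          using ij B by (auto simp: J_def)
        then have "polar (h i) (h j) = 0" "i = j \<Longrightarrow> eval_form f (h i) = 0"
          by (auto simp: radicalD)
        then show ?thesis
          using ij by (cases "i = j")
            (simp_all add: quad_coeff_diag[OF g] quad_coeff_off_diag[OF g] eval_form_coord_change
              matrix_vector_right_distrib Maxis polar_def)
      qed
      have "k \<notin> J" if m: "m \<in> Poly_Mapping.keys ?g" "k \<in> Poly_Mapping.keys m" for m k
      proof -
        obtain i j where ij: "(i, j) \<in> index_pairs" "m = quad_monomial i j"
          using m(1) keys_forms_2[OF g] by auto
        then have "quad_coeff ?g i j \<noteq> 0"
          using m by (simp add: quad_coeff_def in_keys_iff)
        moreover have "k = i \<or> k = j"
          using m(2) ij by (simp add: keys_quad_monomial)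
        ultimately show ?thesis
          using coeff0[OF ij(1)] by blast
      qed
      then show ?thesis
        by (auto simp: indets_def)
    qed
    then have "card (indets (coord_change M f)) \<le> card (- J)"
      by (intro card_mono) auto
    also have "\<dots> = 5 - card J"
      by (simp add: Compl_eq_Diff_UNIV card_Diff_subset)
    finally have "form_rank f \<le> 5 - card J"
      using form_rank_le[OF \<open>invertible M\<close>, of f] by linarith
    moreover have "card J \<le> 5"
      using card_mono[of UNIV J] by simp
    ultimately show ?thesis
      using \<open>card J = vec.dim radical\<close> by linarith
  qed
  ultimately show ?thesis by linarith
qed

section \<open>Counting zeros\<close>

lemma card_pairs: "card {(x::'a::finite, y::'b::finite). R x y} = (\<Sum>x\<in>UNIV. card {y. R x y})"
proof -
  have "{(x, y). R x y} = (SIGMA x:UNIV. {y. R x y})" by auto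
  then show ?thesis by simp
qed

lemma card_pairs_swap: "card {(x::'a::finite, y::'b::finite). R x y} = card {(y, x). R x y}"
proof -
  have "{(y, x). R x y} = prod.swap ` {(x, y). R x y}" by auto
  then show ?thesis by (simp add: card_image)
qed

lemma card_pairs_ge:
  fixes R :: "'a::finite \<Rightarrow> 'b::finite \<Rightarrow> bool"
  assumes "\<And>x. x \<in> U \<Longrightarrow> m \<le> card {y. R x y}"
  shows "card U * m \<le> card {(x, y). x \<in> U \<and> R x y}"
proof -
  have "{(x, y). x \<in> U \<and> R x y} = (SIGMA x:U. {y. R x y})" by auto
  moreover have "card U * m \<le> (\<Sum>x\<in>U. card {y. R x y})"
    using sum_mono[of U "\<lambda>_. m" "\<lambda>x. card {y. R x y}"] assms by simp
  ultimately show ?thesis by simp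
qed

lemma card_neq_eq: "card {x::'b::finite. P x \<noteq> (0::'a::zero)} = CARD('b) - card {x. P x = 0}"
proof -
  have "{x. P x \<noteq> 0} = UNIV - {x. P x = 0}" by auto
  then show ?thesis by (simp add: card_Diff_subset)
qed

subsection \<open>Zeros of polynomials of small degree\<close>

lemma card_linear_roots:
  fixes b c :: "'a::{field,finite}"
  assumes "b \<noteq> 0"
  shows "card {x. b * x + c = 0} \<le> 1"
proof -
  have "x = y" if "b * x + c = 0" "b * y + c = 0" for x y
    using that assms by (metis add_right_cancel mult_cancel_left)
  then show ?thesis
    by (auto simp: card_le_Suc0_iff_eq)
qed

lemma card_quadratic_roots:
  fixes a b c :: "'a::{field,finite}"
  assumes "a \<noteq> 0"
  shows "card {x. a * x\<^sup>2 + b * x + c = 0} \<le> 2"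
proof -
  have "{x. a * x\<^sup>2 + b * x + c = 0} = {x. poly [:c, b, a:] x = 0}"
    by (auto simp: algebra_simps power2_eq_square)
  then show ?thesis
    using card_poly_roots_bound[of "[:c, b, a:]"] assms by simp
qed

text \<open>The homogenization to degree \<open>d\<close> of \<open>P\<close>, on the projective line; \<open>None\<close> is the point at infinity.\<close>
definition binary_at :: "nat \<Rightarrow> 'a::field poly \<Rightarrow> 'a option \<Rightarrow> 'a" where
  "binary_at d P p = (case p of None \<Rightarrow> coeff P d | Some t \<Rightarrow> poly P t)"

lemma binary_at_simps [simp]:
  "binary_at d P None = coeff P d" "binary_at d P (Some t) = poly P t"
  by (simp_all add: binary_at_def)

text \<open>A root at infinity means that the coefficient of degree \<open>d\<close> vanishes, so
  the degree drops and at most \<open>d - 1\<close> finite roots remain.\<close>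

lemma card_binary_roots:
  fixes P :: "'a::{field,finite} poly"
  assumes "P \<noteq> 0" "degree P \<le> d"
  shows "card {p. binary_at d P p = 0} \<le> d"
proof (cases "coeff P d = 0")
  case False
  then have "{p. binary_at d P p = 0} = Some ` {t. poly P t = 0}"
    by (auto simp: binary_at_def image_iff split: option.splits)
  then show ?thesis
    using card_poly_roots_bound[OF assms(1)] assms(2) by (simp add: card_image)
next
  case True
  then have less: "degree P < d"
    using assms by (metis leading_coeff_0_iff le_neq_implies_less)
  have "p \<in> insert None (Some ` {t. poly P t = 0})" if "binary_at d P p = 0" for p
    using that by (cases p) auto
  then have "{p. binary_at d P p = 0} \<subseteq> insert None (Some ` {t. poly P t = 0})"
    by blast
  then have "card {p. binary_at d P p = 0} \<le> card (insert None (Some ` {t. poly P t = 0}))"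
    by (intro card_mono) auto
  also have "\<dots> \<le> Suc (degree P)"
    using card_poly_roots_bound[OF assms(1)] by (simp add: card_image)
  finally show ?thesis
    using less by linarith
qed

lemma card_affine_line:
  fixes a b b' :: "'a::{field,finite}"
  assumes "b \<noteq> 0 \<or> b' \<noteq> 0"
  shows "card {(y, y'). a + b * y + b' * y' = 0} \<le> CARD('a)"
proof -
  have *: "card {(y, y'). a + b * y + b' * y' = 0} \<le> CARD('a)" if "b' \<noteq> 0" for b b' :: 'a
  proof -
    have "card {y'. a + b * y + b' * y' = 0} \<le> 1" for y
      using card_linear_roots[OF that, of "a + b * y"] by (simp add: add.commute)
    then have "(\<Sum>y\<in>UNIV. card {y'. a + b * y + b' * y' = 0}) \<le> (\<Sum>y\<in>(UNIV::'a set). 1)"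
      by (intro sum_mono)
    then show ?thesis by (simp add: card_pairs)
  qed
  show ?thesis
  proof (cases "b' = 0")
    case True
    then show ?thesis
      using *[of b b'] assms
      by (subst card_pairs_swap) (use *[of b b'] in \<open>simp add: ac_simps\<close>)
  qed (rule *)
qed

text \<open>If the square of one variable occurs, every value of the other variable leaves at most
  two solutions. If only the mixed term occurs, the equation is linear in \<open>y'\<close> and
  degenerates for a single \<open>y\<close>.\<close>

lemma card_affine_conic:
  fixes a b b' c1 c2 c3 :: "'a::{field,finite}"
  assumes "c1 \<noteq> 0 \<or> c2 \<noteq> 0 \<or> c3 \<noteq> 0"
  shows "card {(y, y'). a + b * y + b' * y' + (c1 * y\<^sup>2 + c2 * y * y' + c3 * y'\<^sup>2) = 0} \<le> 2 * CARD('a)"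
proof -
  have *: "card {(y, y'). a + b * y + b' * y' + (c1 * y\<^sup>2 + c2 * y * y' + c3 * y'\<^sup>2) = 0} \<le> 2 * CARD('a)"
    if "c3 \<noteq> 0" for b b' c1 c3 :: 'a
  proof -
    have "card {y'. a + b * y + b' * y' + (c1 * y\<^sup>2 + c2 * y * y' + c3 * y'\<^sup>2) = 0} \<le> 2" for y
      using card_quadratic_roots[OF that, of "b' + c2 * y" "a + b * y + c1 * y\<^sup>2"]
      by (simp add: algebra_simps)
    then have "(\<Sum>y\<in>UNIV. card {y'. a + b * y + b' * y' + (c1 * y\<^sup>2 + c2 * y * y' + c3 * y'\<^sup>2) = 0})
        \<le> (\<Sum>y\<in>(UNIV::'a set). 2)"
      by (intro sum_mono)
    then show ?thesis by (simp add: card_pairs)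
  qed
  consider "c3 \<noteq> 0" | "c1 \<noteq> 0" | "c1 = 0" "c3 = 0" "c2 \<noteq> 0"
    using assms by blast
  then show ?thesis
  proof cases
    case 1
    then show ?thesis by (rule *)
  next
    case 2
    then show ?thesis
      by (subst card_pairs_swap) (use *[of c1 b' b c3] in \<open>simp add: ac_simps\<close>)
  next
    case 3
    \<comment> \<open>The only \<open>y\<close> at which the coefficient \<open>b' + c2 * y\<close>
      of \<open>y'\<close> vanishes. It may contribute a whole line of \<open>q\<close> zeros; every
      other \<open>y\<close> contributes at most one.\<close>
    let ?y0 = "- b' / c2"
    have "card {y'. a + b * y + b' * y' + (c1 * y\<^sup>2 + c2 * y * y' + c3 * y'\<^sup>2) = 0}
        \<le> 1 + (if y = ?y0 then CARD('a) else 0)" for y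
    proof (cases "y = ?y0")
      case True
      then show ?thesis
        using card_mono[of UNIV "{y'. a + b * y + b' * y' + (c1 * y\<^sup>2 + c2 * y * y' + c3 * y'\<^sup>2) = 0}"]
        by simp
    next
      case False
      then have "b' + c2 * y \<noteq> 0"
        using 3 by (auto simp: field_simps add_eq_0_iff)
      then show ?thesis
        using card_linear_roots[of "b' + c2 * y" "a + b * y"] 3 by (simp add: algebra_simps)
    qed
    then have "(\<Sum>y\<in>UNIV. card {y'. a + b * y + b' * y' + (c1 * y\<^sup>2 + c2 * y * y' + c3 * y'\<^sup>2) = 0})
        \<le> (\<Sum>y\<in>(UNIV::'a set). 1 + (if y = ?y0 then CARD('a) else 0))"
      by (intro sum_mono)
    also have "\<dots> = 2 * CARD('a)"
      by (simp only: sum.distrib sum.delta finite_UNIV) simp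
    finally show ?thesis by (simp add: card_pairs)
  qed
qed

text \<open>The zeros form at most two lines through the origin, which the lines share:
  \<open>2 * (q - 1) + 1\<close> vectors.\<close>

lemma card_binary_quadratic_zeros:
  fixes a b c :: "'a::{field,finite}"
  assumes "a \<noteq> 0 \<or> b \<noteq> 0 \<or> c \<noteq> 0"
  shows "card {(x, y). a * x\<^sup>2 + b * x * y + c * y\<^sup>2 = 0} + 1 \<le> 2 * CARD('a)"
proof -
  let ?n = "\<lambda>y. card {x. a * x\<^sup>2 + b * x * y + c * y\<^sup>2 = 0}"
  have split: "card {(x, y). a * x\<^sup>2 + b * x * y + c * y\<^sup>2 = 0} = ?n 0 + (\<Sum>y\<in>UNIV - {0}. ?n y)"
    by (subst card_pairs_swap, subst card_pairs) (rule sum.remove, auto)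
  have q: "CARD('a) \<ge> 1"
    by (simp add: Suc_leI)
  show ?thesis
  proof (cases "a = 0")
    case False
    then have "?n 0 = 1"
      by simp
    moreover have "?n y \<le> 2" for y
      using card_quadratic_roots[OF False, of "b * y" "c * y\<^sup>2"] by (simp add: ac_simps)
    then have "(\<Sum>y\<in>UNIV - {0}. ?n y) \<le> (\<Sum>y\<in>UNIV - {0::'a}. 2)"
      by (intro sum_mono)
    then have "(\<Sum>y\<in>UNIV - {0}. ?n y) \<le> (CARD('a) - 1) * 2"
      by (simp add: card_Diff_subset)
    ultimately show ?thesis
      unfolding split using q by linarith
  next
    case True
    have "?n 0 \<le> CARD('a)"
      by (intro card_mono) auto
    moreover have "?n y \<le> 1" if "y \<noteq> 0" for y
    proof (cases "b = 0")
      case True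
      then show ?thesis
        using \<open>a = 0\<close> that assms by simp
    next
      case False
      then show ?thesis
        using card_linear_roots[of "b * y" "c * y\<^sup>2"] that \<open>a = 0\<close> by (simp add: ac_simps)
    qed
    then have "(\<Sum>y\<in>UNIV - {0}. ?n y) \<le> (\<Sum>y\<in>UNIV - {0::'a}. 1)"
      by (intro sum_mono) auto
    then have "(\<Sum>y\<in>UNIV - {0}. ?n y) \<le> CARD('a) - 1"
      by (simp add: card_Diff_subset)
    ultimately show ?thesis
      unfolding split using q by linarith
  qed
qed

subsection \<open>Cones over plane conics\<close>

definition vec5 :: "'a \<Rightarrow> 'a \<Rightarrow> 'a \<Rightarrow> 'a \<Rightarrow> 'a \<Rightarrow> 'a ^ 5" where
  "vec5 a b c d e = (\<chi> i. if i = 0 then a else if i = 1 then b else if i = 2 then c else if i = 3 then d else e)"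

lemma vec5_nth [simp]:
  "vec5 a b c d e $ 0 = a" "vec5 a b c d e $ 1 = b" "vec5 a b c d e $ 2 = c"
  "vec5 a b c d e $ 3 = d" "vec5 a b c d e $ 4 = e"
  by (simp_all add: vec5_def)

lemma vec5_collapse [simp]: "vec5 (z $ 0) (z $ 1) (z $ 2) (z $ 3) (z $ 4) = z"
proof -
  have "vec5 (z $ 0) (z $ 1) (z $ 2) (z $ 3) (z $ 4) $ i = z $ i" for i
    using exhaust_5[of i] by auto
  then show ?thesis by (simp add: vec_eq_iff)
qed

lemma vec5_eq_iff [simp]:
  "vec5 a b c d e = vec5 a' b' c' d' e' \<longleftrightarrow> a = a' \<and> b = b' \<and> c = c' \<and> d = d' \<and> e = e'"
  by (metis vec5_nth)

lemma eval_quadratic_form_5: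
  assumes "g \<in> forms 2"
  shows "eval_form g z =
    quad_coeff g 0 0 * (z $ 0)\<^sup>2 + quad_coeff g 0 1 * z $ 0 * z $ 1 + quad_coeff g 0 2 * z $ 0 * z $ 2 +
    quad_coeff g 0 3 * z $ 0 * z $ 3 + quad_coeff g 0 4 * z $ 0 * z $ 4 +
    quad_coeff g 1 1 * (z $ 1)\<^sup>2 + quad_coeff g 1 2 * z $ 1 * z $ 2 + quad_coeff g 1 3 * z $ 1 * z $ 3 +
    quad_coeff g 1 4 * z $ 1 * z $ 4 + quad_coeff g 2 2 * (z $ 2)\<^sup>2 + quad_coeff g 2 3 * z $ 2 * z $ 3 +
    quad_coeff g 2 4 * z $ 2 * z $ 4 + quad_coeff g 3 3 * (z $ 3)\<^sup>2 + quad_coeff g 3 4 * z $ 3 * z $ 4 +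
    quad_coeff g 4 4 * (z $ 4)\<^sup>2"
  by (simp add: eval_quadratic_form[OF assms] index_pairs_def power2_eq_square algebra_simps)

text \<open>\<open>'a option\<close> serves as the projective line with \<open>q + 1\<close> points;
  outside at most \<open>b\<close> bad parameters every member of the pencil contributes at least
  \<open>L\<close>.\<close>

lemma pencil_bound:
  fixes S :: "'a::finite option \<Rightarrow> 'b set"
  assumes "card {p. bad p} \<le> b" "\<And>p. \<not> bad p \<Longrightarrow> L \<le> card (S p)"
  shows "(CARD('a) + 1 - b) * L \<le> (\<Sum>p\<in>UNIV. card (S p))"
proof -
  have "card {p. \<not> bad p} = CARD('a) + 1 - card {p. bad p}"
    using card_Diff_subset[of "{p. bad p}" UNIV] by (simp add: card_UNIV_option set_diff_eq)
  then have "(CARD('a) + 1 - b) * L \<le> card {p. \<not> bad p} * L"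
    using assms(1) by (intro mult_right_mono) auto
  also have "\<dots> = (\<Sum>p | \<not> bad p. L)" by simp
  also have "\<dots> \<le> (\<Sum>p | \<not> bad p. card (S p))"
    using assms(2) by (intro sum_mono) auto
  also have "\<dots> \<le> (\<Sum>p\<in>UNIV. card (S p))"
    by (intro sum_mono2) auto
  finally show ?thesis .
qed

text \<open>Members of the pencil overlap only in the vertex. When \<open>S p\<close> avoids vertex
  vectors, the joint parametrization is injective and the counts of the planes add up.\<close>

lemma pencil_count:
  fixes S :: "'a::finite option \<Rightarrow> 'b::finite set"
  assumes "\<And>p x. x \<in> S p \<Longrightarrow> \<Phi> p x \<in> W" "inj_on (\<lambda>(p, x). \<Phi> p x) (SIGMA p:UNIV. S p)" "finite W"
  shows "(\<Sum>p\<in>UNIV. card (S p)) \<le> card W"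
proof -
  have "(\<Sum>p\<in>UNIV. card (S p)) = card (SIGMA p:UNIV. S p)"
    by simp
  also have "\<dots> = card ((\<lambda>(p, x). \<Phi> p x) ` (SIGMA p:UNIV. S p))"
    using assms(2) by (simp add: card_image)
  also have "\<dots> \<le> card W"
    using assms by (intro card_mono) auto
  finally show ?thesis .
qed

lemma card_nonzeros_ge:
  fixes h :: "'u::finite \<Rightarrow> 'v::finite \<Rightarrow> 'a::zero"
  assumes "\<And>u. u \<in> U \<Longrightarrow> card {v. h u v = 0} \<le> m"
  shows "card U * (CARD('v) - m) \<le> card {(u, v). u \<in> U \<and> h u v \<noteq> 0}"
proof (rule card_pairs_ge)
  fix u assume "u \<in> U"
  then show "CARD('v) - m \<le> card {v. h u v \<noteq> 0}"
    using assms[of u] card_neq_eq[of "h u"] by linarith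
qed

lemma card_nonzero: "card {x::'a::{field,finite}. x \<noteq> 0} = CARD('a) - 1"
proof -
  have "{x::'a. x \<noteq> 0} = UNIV - {0}" by blast
  then show ?thesis by (simp add: card_Diff_subset)
qed

lemma card_pairs_UNIV: "CARD('a \<times> 'a) = CARD('a::finite)\<^sup>2"
  by (simp add: power2_eq_square)

text \<open>On a plane of the cone \<open>g\<close> is a polynomial in the vertex coordinates
  \<open>y\<close>, \<open>y'\<close>, and the cases follow its top part. If the quadratic part is
  nonzero, it is the same on all planes and each plane loses little; if the linear part is not
  identically zero, it vanishes on at most two planes; if only the term \<open>A\<close> is left, it
  vanishes on at most four. Only this last case gives the bound with equality.\<close>

lemma conic_cone_nonzeros:
  fixes g :: "'a::{field,finite} poly5"
  assumes g: "g \<in> forms 2" and c: "c \<noteq> 0" and q: "CARD('a) \<ge> 4"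
  defines "F \<equiv> \<lambda>z :: 'a ^ 5. z $ 0 * z $ 1 + c * (z $ 2)\<^sup>2"
  shows "(\<exists>k. \<forall>z. eval_form g z = k * F z) \<or>
    (CARD('a) - 1) * ((CARD('a) - 3) * CARD('a)\<^sup>2) \<le> card {z. F z = 0 \<and> eval_form g z \<noteq> 0}"
proof -
  let ?q = "CARD('a)"
  let ?a = "quad_coeff g"
  \<comment> \<open>\<open>PA\<close> is \<open>g\<close> at the conic point (1, - c t^2, t, 0, 0);
    \<open>PB\<close> and \<open>PB'\<close> collect the terms that pair this point with x3 and
    x4.\<close>
  define PA where "PA = [:?a 0 0, ?a 0 2, ?a 2 2 - c * ?a 0 1, - c * ?a 1 2, c\<^sup>2 * ?a 1 1:]"
  define PB where "PB = [:?a 0 3, ?a 2 3, - c * ?a 1 3:]"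
  define PB' where "PB' = [:?a 0 4, ?a 2 4, - c * ?a 1 4:]"
  define A where "A = binary_at 4 PA"
  define B where "B = binary_at 2 PB"
  define B' where "B' = binary_at 2 PB'"
  \<comment> \<open>\<open>l\<close> scales the conic point and \<open>y\<close>, \<open>y'\<close>
    run along the vertex line. The factor \<open>- c\<close> at infinity makes the values there
    agree with the top coefficients of \<open>PA\<close>, \<open>PB\<close> and
    \<open>PB'\<close>.\<close>
  define \<Phi> :: "'a option \<Rightarrow> 'a \<times> 'a \<times> 'a \<Rightarrow> 'a ^ 5" where
    "\<Phi> p = (\<lambda>(l, y, y'). case p of None \<Rightarrow> vec5 0 (- c * l) 0 y y'
      | Some t \<Rightarrow> vec5 l (- c * l * t\<^sup>2) (l * t) y y')" for p
  define h where "h p l = (\<lambda>(y, y'). A p * l\<^sup>2 + (B p * l) * y + (B' p * l) * y' +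
    (?a 3 3 * y\<^sup>2 + ?a 3 4 * y * y' + ?a 4 4 * y'\<^sup>2))" for p l
  define S where "S p = {(l, v). l \<in> {l. l \<noteq> 0} \<and> h p l v \<noteq> 0}" for p
  have eval: "eval_form g (\<Phi> p (l, v)) = h p l v" for p l v
  proof (cases p)
    case None
    then show ?thesis
      by (cases v) (simp add: \<Phi>_def h_def A_def B_def B'_def PA_def PB_def PB'_def
          eval_quadratic_form_5[OF g] numeral_eq_Suc algebra_simps)
  next
    case (Some t)
    then show ?thesis
      by (cases v) (simp add: \<Phi>_def h_def A_def B_def B'_def PA_def PB_def PB'_def
          eval_quadratic_form_5[OF g] power2_eq_square algebra_simps)
  qed
  have W: "(\<Sum>p\<in>UNIV. card (S p)) \<le> card {z. F z = 0 \<and> eval_form g z \<noteq> 0}"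
  proof (rule pencil_count[where \<Phi> = \<Phi>])
    fix p x assume x: "x \<in> S p"
    obtain l v where lv: "x = (l, v)" using surj_pair[of x] by blast
    have "F (\<Phi> p (l, v)) = 0"
      by (cases p; cases v) (simp_all add: F_def \<Phi>_def power2_eq_square)
    then show "\<Phi> p x \<in> {z. F z = 0 \<and> eval_form g z \<noteq> 0}"
      using x by (simp add: lv eval S_def)
  next
    show "inj_on (\<lambda>(p, x). \<Phi> p x) (SIGMA p:UNIV. S p)"
      by (rule inj_onI) (auto simp: S_def \<Phi>_def c split: option.splits)
  qed simp
  have S_ge: "(?q - 1) * (?q\<^sup>2 - m) \<le> card (S p)" if "\<And>l. l \<noteq> 0 \<Longrightarrow> card {v. h p l v = 0} \<le> m" for m p
    using card_nonzeros_ge[of "{l. l \<noteq> 0}" "h p" m] that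
    unfolding S_def card_nonzero card_pairs_UNIV by simp
  show ?thesis
  proof (cases "?a 3 3 \<noteq> 0 \<or> ?a 3 4 \<noteq> 0 \<or> ?a 4 4 \<noteq> 0")
    case True
    have "card {v. h p l v = 0} \<le> 2 * ?q" for p l
      using card_affine_conic[OF True, of "A p * l\<^sup>2" "B p * l" "B' p * l"]
      by (simp add: h_def case_prod_unfold)
    then have "(?q - 1) * (?q\<^sup>2 - 2 * ?q) \<le> card (S p)" for p
      by (rule S_ge)
    then have "(?q + 1 - 0) * ((?q - 1) * (?q\<^sup>2 - 2 * ?q)) \<le> (\<Sum>p\<in>UNIV. card (S p))"
      by (intro pencil_bound[where bad = "\<lambda>_. False"]) auto
    moreover have "(?q - 3) * ?q\<^sup>2 \<le> (?q + 1) * (?q\<^sup>2 - 2 * ?q)"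
    proof -
      obtain r where "?q = r + 4" using q by (metis add.commute le_Suc_ex)
      then show ?thesis by (simp add: power2_eq_square algebra_simps)
    qed
    then have "(?q - 1) * ((?q - 3) * ?q\<^sup>2) \<le> (?q + 1 - 0) * ((?q - 1) * (?q\<^sup>2 - 2 * ?q))"
      using mult_le_mono2[of "(?q - 3) * ?q\<^sup>2" "(?q + 1) * (?q\<^sup>2 - 2 * ?q)" "?q - 1"]
      by (simp only: diff_zero mult.left_commute)
    ultimately show ?thesis
      using W by linarith
  next
    case C0: False
    show ?thesis
    proof (cases "PB = 0 \<and> PB' = 0")
      case False
      have "card {p. B p = 0 \<and> B' p = 0} \<le> 2"
      proof (cases "PB = 0")
        case True
        have "card {p. B p = 0 \<and> B' p = 0} \<le> card {p. B' p = 0}"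
          by (intro card_mono) auto
        also have "\<dots> \<le> 2"
          unfolding B'_def using False True by (intro card_binary_roots) (auto simp: PB'_def)
        finally show ?thesis .
      next
        case False
        have "card {p. B p = 0 \<and> B' p = 0} \<le> card {p. B p = 0}"
          by (intro card_mono) auto
        also have "\<dots> \<le> 2"
          unfolding B_def using False by (intro card_binary_roots) (auto simp: PB_def)
        finally show ?thesis .
      qed
      moreover have "(?q - 1) * (?q\<^sup>2 - ?q) \<le> card (S p)" if "\<not> (B p = 0 \<and> B' p = 0)" for p
      proof (rule S_ge)
        fix l :: 'a assume "l \<noteq> 0"
        then show "card {v. h p l v = 0} \<le> ?q"
          using card_affine_line[of "B p * l" "B' p * l" "A p * l\<^sup>2"] that C0
          by (simp add: h_def case_prod_unfold)
      qed
      ultimately have "(?q + 1 - 2) * ((?q - 1) * (?q\<^sup>2 - ?q)) \<le> (\<Sum>p\<in>UNIV. card (S p))"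
        by (rule pencil_bound)
      moreover have "(?q - 3) * ?q\<^sup>2 \<le> (?q - 1) * (?q\<^sup>2 - ?q)"
      proof -
        obtain r where "?q = r + 4" using q by (metis add.commute le_Suc_ex)
        then show ?thesis by (simp add: power2_eq_square algebra_simps)
      qed
      then have "(?q - 1) * ((?q - 3) * ?q\<^sup>2) \<le> (?q + 1 - 2) * ((?q - 1) * (?q\<^sup>2 - ?q))"
        using mult_le_mono2[of "(?q - 3) * ?q\<^sup>2" "(?q - 1) * (?q\<^sup>2 - ?q)" "?q - 1"]
        by simp
      ultimately show ?thesis
        using W by linarith
    next
      case True
      then have B0: "B p = 0" "B' p = 0" for p
        by (auto simp: B_def B'_def binary_at_def split: option.splits)
      show ?thesis
      proof (cases "PA = 0")
        case False
        have "card {p. A p = 0} \<le> 4"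
          unfolding A_def using False by (intro card_binary_roots) (auto simp: PA_def)
        moreover have "(?q - 1) * (?q\<^sup>2 - 0) \<le> card (S p)" if "A p \<noteq> 0" for p
          by (rule S_ge) (use that B0 C0 in \<open>simp add: h_def case_prod_unfold\<close>)
        ultimately have "(?q + 1 - 4) * ((?q - 1) * (?q\<^sup>2 - 0)) \<le> (\<Sum>p\<in>UNIV. card (S p))"
          by (rule pencil_bound)
        then show ?thesis
          using W by (simp add: mult.left_commute)
      next
        case A0: True
        \<comment> \<open>\<open>PA = 0\<close> kills all coefficients on x0, x1, x2 except those of
          x0 x1 and x2^2, and its middle coefficient forces their ratio to be that in
          \<open>F\<close>.\<close>
        have "eval_form g z = ?a 0 1 * F z" for z
          using True A0 C0 c
          by (simp add: eval_quadratic_form_5[OF g] PA_def PB_def PB'_def F_def algebra_simps)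
        then show ?thesis by blast
      qed
    qed
  qed
qed

subsection \<open>Cones over hyperbolic quadrics\<close>

text \<open>Only one of the two families of planes is used; it already covers the cone. The split is
  on the coefficient \<open>?a 4 4\<close>, the value of \<open>g\<close> at the vertex point: if it
  is nonzero, \<open>g\<close> is a genuine quadratic in \<open>w\<close> along every line through
  the vertex, otherwise it is at most linear there.\<close>

lemma hyperbolic_cone_nonzeros:
  fixes g :: "'a::{field,finite} poly5"
  assumes g: "g \<in> forms 2"
  defines "F \<equiv> \<lambda>z :: 'a ^ 5. z $ 0 * z $ 1 - z $ 2 * z $ 3"
  shows "(\<exists>k. \<forall>z. eval_form g z = k * F z) \<or>
    (CARD('a) - 1) * (CARD('a) * (CARD('a) - 1)\<^sup>2) \<le> card {z. F z = 0 \<and> eval_form g z \<noteq> 0}"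
proof -
  let ?q = "CARD('a)"
  let ?a = "quad_coeff g"
  let ?W = "{z. F z = 0 \<and> eval_form g z \<noteq> 0}"
  have q2: "?q \<ge> 2"
    using card_mono[of UNIV "{0, 1 :: 'a}"] by simp
  define P1 where "P1 = [:?a 0 0, ?a 0 3, ?a 3 3:]"
  define P2 where "P2 = [:?a 0 2, ?a 0 1 + ?a 2 3, ?a 1 3:]"
  define P3 where "P3 = [:?a 2 2, ?a 1 2, ?a 1 1:]"
  define P4 where "P4 = [:?a 0 4, ?a 3 4:]"
  define P5 where "P5 = [:?a 2 4, ?a 1 4:]"
  define A1 where "A1 = binary_at 2 P1"
  define A2 where "A2 = binary_at 2 P2"
  define A3 where "A3 = binary_at 2 P3"
  define A4 where "A4 = binary_at 1 P4"
  define A5 where "A5 = binary_at 1 P5"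
  \<comment> \<open>The plane of parameter \<open>s\<close> is given by x1 = s x2 and x3 = s x0;
    \<open>w\<close> is the coordinate of the vertex point. The coefficients are therefore binary
    forms in \<open>s\<close> of degree 2, and of degree 1 for the terms with
    \<open>w\<close>.\<close>
  define \<Phi> :: "'a option \<Rightarrow> ('a \<times> 'a) \<times> 'a \<Rightarrow> 'a ^ 5" where
    "\<Phi> p = (\<lambda>((x, y), w). case p of None \<Rightarrow> vec5 0 y 0 x w
      | Some s \<Rightarrow> vec5 x (s * y) y (s * x) w)" for p
  define Q where "Q p = (\<lambda>(x, y). A1 p * x\<^sup>2 + A2 p * x * y + A3 p * y\<^sup>2)" for p
  define l where "l p = (\<lambda>(x, y). A4 p * x + A5 p * y)" for p
  define h where "h p u w = Q p u + l p u * w + ?a 4 4 * w\<^sup>2" for p u w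
  define S where "S p = {(u, w). u \<in> {u. u \<noteq> 0} \<and> h p u w \<noteq> 0}" for p
  have eval: "eval_form g (\<Phi> p (u, w)) = h p u w" for p u w
  proof (cases p)
    case None
    then show ?thesis
      by (cases u) (simp add: \<Phi>_def h_def Q_def l_def A1_def A2_def A3_def A4_def A5_def P1_def P2_def
          P3_def P4_def P5_def eval_quadratic_form_5[OF g] numeral_eq_Suc algebra_simps)
  next
    case (Some t)
    then show ?thesis
      by (cases u) (simp add: \<Phi>_def h_def Q_def l_def A1_def A2_def A3_def A4_def A5_def P1_def P2_def
          P3_def P4_def P5_def eval_quadratic_form_5[OF g] power2_eq_square algebra_simps)
  qed
  have F\<Phi>: "F (\<Phi> p (u, w)) = 0" for p u w
    by (cases p; cases u) (simp_all add: F_def \<Phi>_def)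
  have W: "(\<Sum>p\<in>UNIV. card (S p)) \<le> card ?W"
  proof (rule pencil_count[where \<Phi> = \<Phi>])
    fix p x assume x: "x \<in> S p"
    obtain u w where "x = (u, w)" using surj_pair[of x] by blast
    then show "\<Phi> p x \<in> ?W"
      using x F\<Phi> by (simp add: eval S_def)
  next
    show "inj_on (\<lambda>(p, x). \<Phi> p x) (SIGMA p:UNIV. S p)"
      by (rule inj_onI) (auto simp: S_def \<Phi>_def zero_prod_def split: option.splits)
  qed simp
  show ?thesis
  proof (cases "?a 4 4 = 0")
    case False
    have vertex: "vec5 0 0 0 0 1 \<in> ?W"
      using False by (simp add: F_def eval_quadratic_form_5[OF g])
    have ge: "card {u :: 'a \<times> 'a. u \<noteq> 0} * (?q - 2) \<le> card (S p)" for p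
      unfolding S_def
    proof (rule card_nonzeros_ge)
      fix u
      show "card {w. h p u w = 0} \<le> 2"
        using card_quadratic_roots[OF False, of "l p u" "Q p u"] by (simp add: h_def algebra_simps)
    qed
    have card_nz: "card {u :: 'a \<times> 'a. u \<noteq> 0} = ?q\<^sup>2 - 1"
      using card_neq_eq[of "\<lambda>u :: 'a \<times> 'a. u"] by (simp add: power2_eq_square)
    have sum_ge: "(?q + 1 - 0) * ((?q\<^sup>2 - 1) * (?q - 2)) \<le> (\<Sum>p\<in>UNIV. card (S p))"
      using ge unfolding card_nz by (intro pencil_bound[where bad = "\<lambda>_. False"]) auto
    have "(?q - 1) * (?q * (?q - 1)\<^sup>2) \<le> card ?W"
    proof (cases "?q = 2")
      case True
      \<comment> \<open>For \<open>q = 2\<close> the factor \<open>q - 2\<close> makes the plane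
        count empty, and two vectors have to be found. The vertex is one. Where the linear term in
        \<open>w\<close> is zero, the values of \<open>h\<close> at \<open>w = 0\<close> and
        \<open>w = 1\<close> differ, so one of them gives the other vector.\<close>
      obtain x y where xy: "(x, y) \<noteq> (0, 0)" "A4 (Some 0) * x + A5 (Some 0) * y = 0"
      proof (cases "A4 (Some 0) = 0")
        case True
        then show ?thesis using that[of 1 0] by simp
      next
        case False
        then show ?thesis using that[of "- A5 (Some 0) / A4 (Some 0)" 1] by simp
      qed
      then have "h (Some 0) (x, y) w = Q (Some 0) (x, y) + ?a 4 4 * w\<^sup>2" for w
        by (simp add: h_def l_def)
      then obtain w where "h (Some 0) (x, y) w \<noteq> 0"
        using False by (metis add_0_right add_cancel_right_left mult.right_neutral mult_zero_right
            one_power2 zero_power2)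
      then have "\<Phi> (Some 0) ((x, y), w) \<in> ?W"
        using F\<Phi> eval by simp
      moreover have "\<Phi> (Some 0) ((x, y), w) \<noteq> vec5 0 0 0 0 1"
        using xy by (auto simp: \<Phi>_def)
      ultimately have "card {\<Phi> (Some 0) ((x, y), w), vec5 0 0 0 0 1} \<le> card ?W"
        using vertex by (intro card_mono) auto
      then show ?thesis
        using True \<open>\<Phi> (Some 0) ((x, y), w) \<noteq> vec5 0 0 0 0 1\<close> by simp
    next
      case False
      then obtain r where r: "?q = r + 3"
        using q2 by (metis add.commute le_Suc_ex le_antisym not_less_eq_eq numeral_2_eq_2 numeral_3_eq_3)
      have "(?q - 1) * (?q * (?q - 1)\<^sup>2) \<le> (?q + 1 - 0) * ((?q\<^sup>2 - 1) * (?q - 2))"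
        unfolding r by (simp add: power2_eq_square algebra_simps)
      then show ?thesis
        using sum_ge W by linarith
    qed
    then show ?thesis ..
  next
    case e0: True
    define bad where "bad p \<longleftrightarrow> A1 p = 0 \<and> A2 p = 0 \<and> A3 p = 0 \<and> A4 p = 0 \<and> A5 p = 0" for p
    \<comment> \<open>Without linear term in \<open>w\<close>, at least \<open>(q - 1)^2\<close>
      vectors \<open>u\<close> work with all \<open>q\<close> values of \<open>w\<close>. With one,
      at least \<open>q * (q - 1)\<close> vectors \<open>u\<close> work with at least
      \<open>q - 1\<close> values each. Both products are the same.\<close>
    have S_ge: "?q * (?q - 1)\<^sup>2 \<le> card (S p)" if "\<not> bad p" for p
    proof (cases "A4 p = 0 \<and> A5 p = 0")
      case True
      have "card {u. Q p u = 0} + 1 \<le> 2 * ?q"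
        using card_binary_quadratic_zeros[of "A1 p" "A2 p" "A3 p"] True that
        by (simp add: bad_def Q_def case_prod_unfold)
      then have "?q\<^sup>2 - (2 * ?q - 1) \<le> card {u. Q p u \<noteq> 0}"
        using card_neq_eq[of "Q p"] card_pairs_UNIV[where 'a='a] by linarith
      moreover have "?q\<^sup>2 - (2 * ?q - 1) = (?q - 1)\<^sup>2"
      proof -
        obtain r where "?q = r + 1" using q2 by (metis Suc_eq_plus1 Suc_pred' zero_less_card_finite)
        then show ?thesis by (simp add: power2_eq_square algebra_simps)
      qed
      ultimately have "(?q - 1)\<^sup>2 * ?q \<le> card {u. Q p u \<noteq> 0} * card (UNIV :: 'a set)"
        by simp
      also have "\<dots> = card ({u. Q p u \<noteq> 0} \<times> (UNIV :: 'a set))"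
        by simp
      also have "\<dots> \<le> card (S p)"
        by (intro card_mono) (use True in \<open>auto simp: S_def h_def l_def e0 Q_def zero_prod_def\<close>)
      finally show ?thesis by (simp add: mult.commute)
    next
      case False
      have "card {u. l p u = 0} \<le> ?q"
        using card_affine_line[of "A4 p" "A5 p" 0] False
        by (simp add: l_def case_prod_unfold)
      then have "?q\<^sup>2 - ?q \<le> card {u. l p u \<noteq> 0}"
        using card_neq_eq[of "l p"] card_pairs_UNIV[where 'a='a] by linarith
      then have "(?q\<^sup>2 - ?q) * (?q - 1) \<le> card {u. l p u \<noteq> 0} * (?q - 1)"
        by simp
      also have "\<dots> \<le> card {(u, w). u \<in> {u. l p u \<noteq> 0} \<and> h p u w \<noteq> 0}"
      proof (rule card_nonzeros_ge)
        fix u assume "u \<in> {u. l p u \<noteq> 0}"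
        then show "card {w. h p u w = 0} \<le> 1"
          using card_linear_roots[of "l p u" "Q p u"] by (simp add: h_def e0 add.commute)
      qed
      also have "\<dots> \<le> card (S p)"
        by (intro card_mono) (auto simp: S_def l_def zero_prod_def)
      finally have "(?q\<^sup>2 - ?q) * (?q - 1) \<le> card (S p)" .
      moreover have "?q\<^sup>2 - ?q = ?q * (?q - 1)"
        by (simp add: power2_eq_square diff_mult_distrib2)
      then have "(?q\<^sup>2 - ?q) * (?q - 1) = ?q * (?q - 1)\<^sup>2"
        by (simp only: power2_eq_square mult.assoc)
      ultimately show ?thesis by linarith
    qed
    show ?thesis
    proof (cases "P1 = 0 \<and> P2 = 0 \<and> P3 = 0 \<and> P4 = 0 \<and> P5 = 0")
      case True
      \<comment> \<open>On this family x0 x1 and x2 x3 restrict to the same term, so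
        \<open>P2 = 0\<close> bounds only the sum of their coefficients; this is where the multiple
        of \<open>F\<close> survives.\<close>
      then have "?a 2 3 = - ?a 0 1"
        by (simp add: P2_def add_eq_0_iff)
      then have "eval_form g z = ?a 0 1 * F z" for z
        using e0 True by (simp add: eval_quadratic_form_5[OF g] P1_def P2_def P3_def P4_def P5_def
            F_def right_diff_distrib mult.assoc)
      then show ?thesis by blast
    next
      case nz: False
      have le: "card {p. bad p} \<le> 2" if "P \<noteq> 0" "degree P \<le> d" "d \<le> 2" "\<And>p. bad p \<Longrightarrow> binary_at d P p = 0" for P d
      proof -
        have "card {p. bad p} \<le> card {p. binary_at d P p = 0}"
          using that by (intro card_mono) auto
        then show ?thesis
          using card_binary_roots[OF that(1,2)] that(3) by linarith
      qed
      have "card {p. bad p} \<le> 2"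
      proof (cases "P1 = 0")
        case False
        then show ?thesis by (rule le[of _ 2]) (auto simp: P1_def bad_def A1_def)
      next
        case 1: True
        show ?thesis
        proof (cases "P2 = 0")
          case False
          then show ?thesis by (rule le[of _ 2]) (auto simp: P2_def bad_def A2_def)
        next
          case 2: True
          show ?thesis
          proof (cases "P3 = 0")
            case False
            then show ?thesis by (rule le[of _ 2]) (auto simp: P3_def bad_def A3_def)
          next
            case 3: True
            show ?thesis
            proof (cases "P4 = 0")
              case False
              then show ?thesis by (rule le[of _ 1]) (auto simp: P4_def bad_def A4_def)
            next
              case True
              with nz 1 2 3 have "P5 \<noteq> 0" by simp
              then show ?thesis by (rule le[of _ 1]) (auto simp: P5_def bad_def A5_def)
            qed
          qed
        qed
      qed
      then have "(?q + 1 - 2) * (?q * (?q - 1)\<^sup>2) \<le> (\<Sum>p\<in>UNIV. card (S p))"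
        using S_ge by (rule pencil_bound)
      then show ?thesis
        using W by simp
    qed
  qed
qed

subsection \<open>Exact counts\<close>

text \<open>If x0 is nonzero, x1 is determined by the rest; if x0 = 0, then x2 = 0 and x1 is
  free.\<close>

lemma card_conic_cone:
  fixes c :: "'a::{field,finite}"
  assumes "c \<noteq> 0"
  shows "card {z :: 'a ^ 5. z $ 0 * z $ 1 + c * (z $ 2)\<^sup>2 = 0} = CARD('a) ^ 4"
proof -
  let ?A = "(\<lambda>(x0, x2, x3, x4). vec5 x0 (- c * x2\<^sup>2 / x0) x2 x3 x4) ` ({x :: 'a. x \<noteq> 0} \<times> UNIV)"
  let ?B = "(\<lambda>(x1, x3, x4). vec5 0 x1 0 x3 (x4 :: 'a)) ` UNIV"
  have "z \<in> ?A \<union> ?B" if "z $ 0 * z $ 1 + c * (z $ 2)\<^sup>2 = 0" for z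
  proof (cases "z $ 0 = 0")
    case True
    then have "z = vec5 0 (z $ 1) 0 (z $ 3) (z $ 4)"
      using that assms vec5_collapse[of z] by simp
    then show ?thesis by (auto simp: image_iff)
  next
    case False
    then have "z = vec5 (z $ 0) (- c * (z $ 2)\<^sup>2 / z $ 0) (z $ 2) (z $ 3) (z $ 4)"
      using that vec5_collapse[of z] by (simp add: field_simps add_eq_0_iff)
    then show ?thesis using False by (auto simp: image_iff)
  qed
  then have "{z. z $ 0 * z $ 1 + c * (z $ 2)\<^sup>2 = 0} = ?A \<union> ?B"
    by auto
  moreover have "?A \<inter> ?B = {}" by auto
  moreover have "card ?A = (CARD('a) - 1) * CARD('a) ^ 3"
    by (subst card_image) (auto simp: inj_on_def card_cartesian_product card_nonzero power3_eq_cube)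
  moreover have "card ?B = CARD('a) ^ 3"
    by (subst card_image) (auto simp: inj_on_def power3_eq_cube)
  moreover have "(CARD('a) - 1) * CARD('a) ^ 3 + CARD('a) ^ 3 = CARD('a) ^ 4"
  proof -
    obtain r where "CARD('a) = r + 1" by (metis Suc_eq_plus1 Suc_pred' zero_less_card_finite)
    then show ?thesis by (simp add: numeral_eq_Suc)
  qed
  ultimately show ?thesis
    by (simp add: card_Un_disjoint)
qed

text \<open>On the plane of parameter \<open>s\<close> the product is
  \<open>- c * s * (s - 1) * (s - k) * x^2\<close>, and it vanishes on the plane at infinity. The
  two hyperplanes are spanned by the vertex line and the secants of the conic through the parameters
  0, infinity and 1, \<open>k\<close>.\<close>

lemma card_conic_cone_minus_four_planes:
  fixes c k :: "'a::{field,finite}"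
  assumes "c \<noteq> 0" "k \<noteq> 0" "k \<noteq> 1"
  shows "card {z :: 'a ^ 5. z $ 0 * z $ 1 + c * (z $ 2)\<^sup>2 = 0 \<and>
      z $ 2 * (z $ 1 + c * (1 + k) * z $ 2 - c * k * z $ 0) \<noteq> 0} =
    (CARD('a) - 1) * ((CARD('a) - 3) * CARD('a)\<^sup>2)" (is "card ?S = _")
proof -
  let ?U = "({x :: 'a. x \<noteq> 0} \<times> ((UNIV - {0, 1, k}) \<times> (UNIV :: ('a \<times> 'a) set)))"
  let ?\<phi> = "\<lambda>(x, s, y, w). vec5 x (- c * s\<^sup>2 * x) (s * x) y (w :: 'a)"
  have factor: "z $ 2 * (z $ 1 + c * (1 + k) * z $ 2 - c * k * z $ 0) = - c * s * (s - 1) * (s - k) * x\<^sup>2"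
    if "z $ 0 = x" "z $ 1 = - c * s\<^sup>2 * x" "z $ 2 = s * x" for z :: "'a ^ 5" and x s
    by (simp add: that power2_eq_square algebra_simps)
  have "z \<in> ?\<phi> ` ?U" if z: "z \<in> ?S" for z
  proof -
    have z2: "z $ 2 \<noteq> 0" using z by auto
    have z0: "z $ 0 \<noteq> 0" using z z2 assms by auto
    define s where "s = z $ 2 / z $ 0"
    have 2: "z $ 2 = s * z $ 0" using z0 by (simp add: s_def)
    have "z $ 0 * (z $ 1 + c * s\<^sup>2 * z $ 0) = 0"
      using z by (simp add: 2 power2_eq_square algebra_simps)
    then have 1: "z $ 1 = - c * s\<^sup>2 * z $ 0"
      using z0 by (simp add: add_eq_0_iff2)
    have "s \<notin> {0, 1, k}"
      using factor[OF refl 1 2] z by auto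
    moreover have "z = vec5 (z $ 0) (- c * s\<^sup>2 * z $ 0) (s * z $ 0) (z $ 3) (z $ 4)"
      using vec5_collapse[of z] 1 2 by simp
    ultimately show ?thesis
      using z0 by (auto simp: image_iff)
  qed
  then have "?S \<subseteq> ?\<phi> ` ?U"
    by blast
  moreover have "?\<phi> u \<in> ?S" if u_in: "u \<in> ?U" for u
  proof -
    obtain x s y w where u: "u = (x, s, y, w)" "x \<noteq> 0" "s \<notin> {0, 1, k}"
      using u_in by (cases u) auto
    define z where "z = ?\<phi> (x, s, y, w)"
    have z: "z $ 0 = x" "z $ 1 = - c * s\<^sup>2 * x" "z $ 2 = s * x"
      by (simp_all add: z_def)
    have "z $ 2 * (z $ 1 + c * (1 + k) * z $ 2 - c * k * z $ 0) \<noteq> 0"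
      unfolding factor[OF z] using u assms by simp
    moreover have "z $ 0 * z $ 1 + c * (z $ 2)\<^sup>2 = 0"
      by (simp add: z power2_eq_square)
    ultimately show ?thesis
      by (simp add: z_def u(1))
  qed
  then have "?\<phi> ` ?U \<subseteq> ?S"
    by blast
  ultimately have "?S = ?\<phi> ` ?U"
    by (rule subset_antisym)
  moreover have "inj_on ?\<phi> ?U"
    by (auto simp: inj_on_def)
  ultimately have "card ?S = card ?U"
    by (simp only: card_image)
  also have "card (UNIV - {0, 1, k}) = CARD('a) - 3"
    using assms by (simp add: card_Diff_subset)
  then have "card ?U = (CARD('a) - 1) * ((CARD('a) - 3) * CARD('a)\<^sup>2)"
    by (simp add: card_cartesian_product card_nonzero power2_eq_square)
  finally show ?thesis .
qed

lemma card_hyperbolic_cone: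
  "card {z :: 'a::{field,finite} ^ 5. z $ 0 * z $ 1 - z $ 2 * z $ 3 = 0} + CARD('a)\<^sup>2 =
    CARD('a) ^ 4 + CARD('a) ^ 3" (is "card ?S + _ = _")
proof -
  let ?A = "(\<lambda>(x0, x2, x3, x4). vec5 x0 (x2 * x3 / x0) x2 x3 x4) ` ({x :: 'a. x \<noteq> 0} \<times> UNIV)"
  let ?B = "(\<lambda>(x1, x3, x4). vec5 0 x1 0 x3 (x4 :: 'a)) ` UNIV"
  let ?C = "(\<lambda>(x2, x1, x4). vec5 0 x1 x2 0 (x4 :: 'a)) ` ({x :: 'a. x \<noteq> 0} \<times> UNIV)"
  have "z \<in> ?A \<union> ?B \<union> ?C" if z: "z \<in> ?S" for z
  proof (cases "z $ 0 = 0")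
    case True
    obtain x1 x2 x3 x4 where "z = vec5 0 x1 x2 x3 x4"
      using True vec5_collapse[of z] by metis
    then show ?thesis
      using z by (cases "x2 = 0") (auto simp: image_iff)
  next
    case False
    then have "z $ 1 = z $ 2 * z $ 3 / z $ 0"
      using z by (simp add: field_simps)
    then obtain x0 x2 x3 x4 where "z = vec5 x0 (x2 * x3 / x0) x2 x3 x4" "x0 \<noteq> 0"
      using False vec5_collapse[of z] by metis
    then show ?thesis by (auto simp: image_iff)
  qed
  then have "?S = (?A \<union> ?B) \<union> ?C"
    by auto
  moreover have "?A \<inter> ?B = {}" "(?A \<union> ?B) \<inter> ?C = {}" by auto
  moreover have "card ?A = (CARD('a) - 1) * CARD('a) ^ 3"
    by (subst card_image) (auto simp: inj_on_def card_cartesian_product card_nonzero power3_eq_cube)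
  moreover have "card ?B = CARD('a) ^ 3"
    by (subst card_image) (auto simp: inj_on_def power3_eq_cube)
  moreover have "card ?C = (CARD('a) - 1) * CARD('a)\<^sup>2"
    by (subst card_image) (auto simp: inj_on_def card_cartesian_product card_nonzero power2_eq_square)
  ultimately have "card ?S = (CARD('a) - 1) * CARD('a) ^ 3 + CARD('a) ^ 3 + (CARD('a) - 1) * CARD('a)\<^sup>2"
    by (simp add: card_Un_disjoint)
  moreover obtain r where "CARD('a) = r + 1" by (metis Suc_eq_plus1 Suc_pred' zero_less_card_finite)
  ultimately show ?thesis
    by (simp add: numeral_eq_Suc)
qed

text \<open>From x0 x1 = x2 x3 nonzero it follows that all four coordinates are nonzero; x3 is then
  determined and x4 is free.\<close>

lemma card_hyperbolic_cone_minus_four_planes: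
  "card {z :: 'a::{field,finite} ^ 5. z $ 0 * z $ 1 - z $ 2 * z $ 3 = 0 \<and> z $ 0 * z $ 1 \<noteq> 0} =
    (CARD('a) - 1) * (CARD('a) * (CARD('a) - 1)\<^sup>2)" (is "card ?S = _")
proof -
  let ?N = "{x :: 'a. x \<noteq> 0}"
  let ?\<phi> = "\<lambda>(x0, x1, x2, x4). vec5 x0 x1 x2 (x0 * x1 / x2) (x4 :: 'a)"
  have "z \<in> ?\<phi> ` (?N \<times> ?N \<times> ?N \<times> UNIV)" if z: "z \<in> ?S" for z
  proof -
    have nz: "z $ 0 \<noteq> 0" "z $ 1 \<noteq> 0" "z $ 2 \<noteq> 0" using z by auto
    then have "z $ 3 = z $ 0 * z $ 1 / z $ 2"
      using z by (simp add: field_simps)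
    then have "z = vec5 (z $ 0) (z $ 1) (z $ 2) (z $ 0 * z $ 1 / z $ 2) (z $ 4)"
      using vec5_collapse[of z] by simp
    then show ?thesis using nz by (auto simp: image_iff)
  qed
  then have "?S = ?\<phi> ` (?N \<times> ?N \<times> ?N \<times> UNIV)"
    by auto
  moreover have "inj_on ?\<phi> (?N \<times> ?N \<times> ?N \<times> UNIV)"
    by (auto simp: inj_on_def)
  ultimately show ?thesis
    by (simp add: card_image card_cartesian_product card_nonzero power2_eq_square)
qed

section \<open>Parameters of the code\<close>

lemma span_scale_eq:
  fixes x :: "'a::field ^ 5"
  assumes "a \<noteq> 0"
  shows "vec.span {a *s x} = vec.span {x}"
proof
  show "vec.span {a *s x} \<subseteq> vec.span {x}"
    by (intro vec.span_minimal) (auto intro: vec.span_scale vec.span_base)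
  have "inverse a *s (a *s x) \<in> vec.span {a *s x}"
    by (intro vec.span_scale vec.span_base) simp
  then show "vec.span {x} \<subseteq> vec.span {a *s x}"
    using assms by (intro vec.span_minimal) (auto simp: vec.scale_scale)
qed

text \<open>Each projective point has \<open>q - 1\<close> nonzero representatives, all of them in
  \<open>T\<close>. Both the length and the weights are converted in this way.\<close>

lemma card_punctured_cone:
  fixes T :: "('a::{field,finite} ^ 5) set"
  assumes "0 \<notin> T" and closed: "\<And>a x. a \<noteq> 0 \<Longrightarrow> x \<in> T \<Longrightarrow> a *s x \<in> T"
  shows "card T = (CARD('a) - 1) * card ((\<lambda>x. vec.span {x}) ` T)"
proof -
  have fibre: "card {x \<in> T. vec.span {x} = P} = CARD('a) - 1" if P: "P \<in> (\<lambda>x. vec.span {x}) ` T" for P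
  proof -
    obtain y where y: "y \<in> T" "P = vec.span {y}" using P by blast
    have y0: "y \<noteq> 0" using y assms(1) by blast
    have "{x \<in> T. vec.span {x} = P} = (\<lambda>a. a *s y) ` {a. a \<noteq> 0}"
    proof
      show "{x \<in> T. vec.span {x} = P} \<subseteq> (\<lambda>a. a *s y) ` {a. a \<noteq> 0}"
      proof clarify
        fix x assume x: "x \<in> T" "P = vec.span {x}"
        then have "x \<in> vec.span {y}"
          using y vec.span_base[of x "{x}"] by simp
        then obtain a where "x = a *s y"
          by (auto simp: vec.span_singleton)
        moreover from this have "a \<noteq> 0"
          using x assms(1) by auto
        ultimately show "x \<in> (\<lambda>a. a *s y) ` {a. a \<noteq> 0}" by blast
      qed
      show "(\<lambda>a. a *s y) ` {a. a \<noteq> 0} \<subseteq> {x \<in> T. vec.span {x} = P}"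
      proof (rule image_subsetI)
        fix a :: 'a assume "a \<in> {a. a \<noteq> 0}"
        then have a: "a \<noteq> 0" by simp
        show "a *s y \<in> {x \<in> T. vec.span {x} = P}"
          using closed[OF a y(1)] span_scale_eq[OF a, of y] y(2) by simp
      qed
    qed
    moreover have "inj_on (\<lambda>a. a *s y) {a. a \<noteq> 0}"
      using y0 by (auto simp: inj_on_def)
    ultimately show ?thesis
      by (simp add: card_image card_nonzero)
  qed
  have "card T = (\<Sum>P\<in>(\<lambda>x. vec.span {x}) ` T. \<Sum>x\<in>{x \<in> T. vec.span {x} = P}. 1)"
    by (subst sum.image_gen[symmetric]) simp_all
  also have "\<dots> = (\<Sum>P\<in>(\<lambda>x. vec.span {x}) ` T. CARD('a) - 1)"
    using fibre by (intro sum.cong) auto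
  finally show ?thesis by (simp add: mult.commute)
qed

lemma eval_form_quadratic_zero: "f \<in> forms 2 \<Longrightarrow> eval_form f 0 = 0"
  using eval_form_scale[of f 2 0 0] by simp

lemma zero_set_eq_image:
  assumes "f \<in> forms 2"
  shows "zero_set f = (\<lambda>x. vec.span {x}) ` {x. x \<noteq> 0 \<and> eval_form f x = 0}"
proof
  show "zero_set f \<subseteq> (\<lambda>x. vec.span {x}) ` {x. x \<noteq> 0 \<and> eval_form f x = 0}"
    by (auto simp: zero_set_def proj_points_def intro: vec.span_base)
  show "(\<lambda>x. vec.span {x}) ` {x. x \<noteq> 0 \<and> eval_form f x = 0} \<subseteq> zero_set f"
    by (auto simp: zero_set_def proj_points_def vec.span_singleton eval_form_scale[OF assms])
qed

lemma card_affine_zeros: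
  fixes f :: "'a::{field,finite} poly5"
  assumes f: "f \<in> forms 2"
  shows "card {x. eval_form f x = 0} = 1 + (CARD('a) - 1) * card (zero_set f)"
proof -
  have "{x. eval_form f x = 0} = insert 0 {x. x \<noteq> 0 \<and> eval_form f x = 0}"
    using eval_form_quadratic_zero[OF f] by auto
  then have "card {x. eval_form f x = 0} = 1 + card {x. x \<noteq> 0 \<and> eval_form f x = 0}"
    by simp
  also have "card {x. x \<noteq> 0 \<and> eval_form f x = 0} = (CARD('a) - 1) * card (zero_set f)"
    unfolding zero_set_eq_image[OF f]
    by (rule card_punctured_cone) (auto simp: eval_form_scale[OF f])
  finally show ?thesis .
qed

lemma zero_set_subset: "zero_set f \<subseteq> proj_points"
  by (auto simp: zero_set_def)

lemma weight_affine:
  fixes f g :: "'a::{field,finite} poly5"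
  assumes f: "f \<in> forms 2" and g: "g \<in> forms 2"
  shows "(CARD('a) - 1) * weight (codeword (zero_set f) g) =
    card {x. eval_form f x = 0 \<and> eval_form g x \<noteq> 0}"
proof -
  let ?T = "{x. eval_form f x = 0 \<and> eval_form g x \<noteq> 0}"
  have nz: "eval_form g x \<noteq> 0 \<Longrightarrow> x \<noteq> 0" for x
    using eval_form_quadratic_zero[OF g] by auto
  have "{P. codeword (zero_set f) g P \<noteq> 0} = {P \<in> zero_set f. form_value g P \<noteq> 0}"
    by (auto simp: codeword_def)
  also have "\<dots> = (\<lambda>x. vec.span {x}) ` ?T"
  proof -
    have "form_value g (vec.span {x}) = 0 \<longleftrightarrow> eval_form g x = 0" if x: "x \<noteq> 0" for x
    proof -
      have "vec.span {x} \<in> proj_points"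
        using x by (auto simp: proj_points_def)
      then show ?thesis
        using form_value_eq[OF g _ _ x] first_nz_nonzero[OF x] by (simp add: vec.span_base)
    qed
    then show ?thesis
      unfolding zero_set_eq_image[OF f] using nz by auto
  qed
  finally have "weight (codeword (zero_set f) g) = card ((\<lambda>x. vec.span {x}) ` ?T)"
    by (simp add: weight_def)
  moreover have "card ?T = (CARD('a) - 1) * card ((\<lambda>x. vec.span {x}) ` ?T)"
    by (rule card_punctured_cone)
      (auto simp: eval_form_scale[OF f] eval_form_scale[OF g] eval_form_quadratic_zero[OF g])
  ultimately show ?thesis by simp
qed

section \<open>Linearity, kernel and dimension of the code\<close>

lemma form_value_add: "form_value (f + g) P = form_value f P + form_value g P"
  by (simp add: form_value_def Let_def eval_form_add add_divide_distrib)

lemma form_value_scale: "form_value (const_poly a * f) P = a * form_value f P"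
  by (simp add: form_value_def Let_def eval_form_mult)

lemma codeword_add: "codeword X (f + g) = codeword X f + codeword X g"
  by (simp add: codeword_def fun_eq_iff form_value_add)

lemma codeword_scale: "codeword X (const_poly a * f) = fun_scale a (codeword X f)"
  by (simp add: codeword_def fun_eq_iff form_value_scale fun_scale_def)

lemma codeword_diff: "codeword X (f - g) = codeword X f - codeword X g"
  using codeword_add[of X "f - g" g] by (simp add: algebra_simps)

lemma forms_diff: "f \<in> forms h \<Longrightarrow> g \<in> forms h \<Longrightarrow> f - g \<in> forms h"
  using keys_diff[of f g] by (auto simp: forms_def)

lemma codeword_zero: "codeword X 0 = 0"
  using codeword_diff[of X 0 0] by simp

lemma subspace_functional_code: "fun_vs.subspace (functional_code X)"
  unfolding fun_vs.subspace_def functional_code_def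
proof (intro conjI ballI allI)
  show "0 \<in> codeword X ` forms 2"
    using codeword_zero forms_zero by (metis imageI)
  show "x + y \<in> codeword X ` forms 2" if "x \<in> codeword X ` forms 2" "y \<in> codeword X ` forms 2" for x y
    using that by (auto simp flip: codeword_add intro: forms_add)
  show "fun_scale c x \<in> codeword X ` forms 2" if "x \<in> codeword X ` forms 2" for c x
    using that by (auto simp flip: codeword_scale intro: forms_const_mult)
qed

text \<open>By induction, each new basis vector multiplies the size by \<open>q\<close>. This is
  what turns a count of codewords into a dimension.\<close>

lemma card_fun_vs_span:
  fixes B :: "('p \<Rightarrow> 'a::{field,finite}) set"
  assumes "finite B" "fun_vs.independent B"
  shows "card (fun_vs.span B) = CARD('a) ^ card B"
  using assms
proof (induct B rule: finite_induct)
  case empty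
  then show ?case by simp
next
  case (insert b B)
  have ind: "fun_vs.independent B" "b \<notin> fun_vs.span B"
    using insert.prems insert.hyps by (auto simp: fun_vs.independent_insert)
  let ?\<phi> = "\<lambda>(k, x). fun_scale k b + x"
  have "fun_vs.span (insert b B) = ?\<phi> ` (UNIV \<times> fun_vs.span B)"
  proof
    show "fun_vs.span (insert b B) \<subseteq> ?\<phi> ` (UNIV \<times> fun_vs.span B)"
    proof
      fix x assume "x \<in> fun_vs.span (insert b B)"
      then obtain k where "x - fun_scale k b \<in> fun_vs.span B"
        using fun_vs.span_breakdown_eq by blast
      then show "x \<in> ?\<phi> ` (UNIV \<times> fun_vs.span B)"
        by (intro image_eqI[of _ _ "(k, x - fun_scale k b)"]) auto
    qed
    show "?\<phi> ` (UNIV \<times> fun_vs.span B) \<subseteq> fun_vs.span (insert b B)"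
      using fun_vs.span_mono[of B "insert b B"]
      by (auto intro!: fun_vs.span_add fun_vs.span_scale intro: fun_vs.span_base)
  qed
  moreover have "inj_on ?\<phi> (UNIV \<times> fun_vs.span B)"
  proof (rule inj_onI, clarify)
    fix k x l y assume *: "x \<in> fun_vs.span B" "y \<in> fun_vs.span B" "fun_scale k b + x = fun_scale l b + y"
    then have "fun_scale (k - l) b = y - x"
      by (simp add: fun_vs.scale_left_diff_distrib algebra_simps)
    then have "fun_scale (k - l) b \<in> fun_vs.span B"
      using * by (simp add: fun_vs.span_diff)
    then have "k = l"
      using ind(2) fun_vs.span_scale[of "fun_scale (k - l) b" B "inverse (k - l)"]
      by (cases "k = l") simp_all
    then show "k = l \<and> x = y" using * by simp
  qed
  ultimately have "card (fun_vs.span (insert b B)) = CARD('a) * card (fun_vs.span B)"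
    by (simp add: card_image card_cartesian_product)
  then show ?case
    using insert ind by simp
qed

lemma CARD_field_ge_2: "CARD('a::{field,finite}) \<ge> 2"
  using card_mono[of UNIV "{0, 1 :: 'a}"] by simp

text \<open>The fibres of the evaluation map are cosets of the line spanned by \<open>f\<close>,
  hence of size \<open>q\<close>; so \<open>q^15\<close> forms yield \<open>q^14\<close>
  codewords.\<close>

lemma dim_functional_code:
  fixes f :: "'a::{field,finite} poly5"
  assumes f: "f \<in> forms 2" "f \<noteq> 0"
    and ker: "\<And>g. g \<in> forms 2 \<Longrightarrow> codeword (zero_set f) g = 0 \<longleftrightarrow> (\<exists>k. g = const_poly k * f)"
  shows "fun_vs.dim (functional_code (zero_set f)) = 14"
proof -
  let ?c = "codeword (zero_set f)"
  let ?C = "functional_code (zero_set f)"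
  \<comment> \<open>A nonzero quadratic form is a nonzero function even for \<open>q = 2\<close>;
    its value at \<open>x\<close> separates the multiples of \<open>f\<close>.\<close>
  obtain x where x: "eval_form f x \<noteq> 0"
    using quadratic_form_eq_iff_eval[OF f(1) forms_zero] f(2) by (auto simp: fun_eq_iff)
  have fin: "finite (forms 2 :: 'a poly5 set)"
    using card_forms_2[where 'a='a] by (intro card_ge_0_finite) simp
  have fibre: "card {g \<in> forms 2. ?c g = w} = CARD('a)" if w: "w \<in> ?c ` forms 2" for w
  proof -
    obtain g where g: "g \<in> forms 2" "w = ?c g" using w by blast
    have "{g \<in> forms 2. ?c g = w} = (\<lambda>k. g + const_poly k * f) ` UNIV"
    proof
      show "{g \<in> forms 2. ?c g = w} \<subseteq> (\<lambda>k. g + const_poly k * f) ` UNIV"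
      proof clarify
        fix g' assume g': "g' \<in> forms 2" "w = ?c g'"
        then have "?c (g' - g) = 0"
          using g by (simp add: codeword_diff)
        then obtain k where "g' - g = const_poly k * f"
          using ker[OF forms_diff[OF g'(1) g(1)]] by blast
        then have "g' = g + const_poly k * f"
          by (simp add: algebra_simps)
        then show "g' \<in> range (\<lambda>k. g + const_poly k * f)" by blast
      qed
      have "?c (const_poly k * f) = 0" for k
        using ker[OF forms_const_mult[OF f(1)]] by blast
      then show "(\<lambda>k. g + const_poly k * f) ` UNIV \<subseteq> {g \<in> forms 2. ?c g = w}"
        using g by (auto simp: codeword_add forms_add forms_const_mult f)
    qed
    moreover have "inj (\<lambda>k. g + const_poly k * f)"
    proof (rule injI)
      fix k l assume "g + const_poly k * f = g + const_poly l * f"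
      then have "const_poly k * f = const_poly l * f"
        by (rule add_left_imp_eq)
      then have "eval_form (const_poly k * f) x = eval_form (const_poly l * f) x"
        by (rule arg_cong)
      then show "k = l"
        using x by (simp add: eval_form_mult)
    qed
    ultimately show ?thesis
      by (simp add: card_image)
  qed
  have "CARD('a) ^ 15 = card (forms 2 :: 'a poly5 set)"
    by (simp add: card_forms_2)
  also have "\<dots> = (\<Sum>w\<in>?c ` forms 2. \<Sum>g\<in>{g \<in> forms 2. ?c g = w}. 1)"
    by (subst sum.image_gen[OF fin, symmetric]) simp_all
  also have "\<dots> = card ?C * CARD('a)"
    using fibre by (simp add: functional_code_def)
  finally have card_C: "card ?C = CARD('a) ^ 14"
    using CARD_field_ge_2[where 'a='a] by (simp add: numeral_eq_Suc)
  obtain B where B: "B \<subseteq> ?C" "fun_vs.independent B" "?C \<subseteq> fun_vs.span B" "card B = fun_vs.dim ?C"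
    using fun_vs.basis_exists[of ?C] by metis
  have "finite B"
    using B(1) fin by (auto simp: functional_code_def intro: finite_subset)
  moreover have "fun_vs.span B = ?C"
    using B subspace_functional_code by (intro subset_antisym fun_vs.span_minimal)
  ultimately have "CARD('a) ^ fun_vs.dim ?C = CARD('a) ^ 14"
    using card_fun_vs_span[of B] B card_C by simp
  then show ?thesis
    using CARD_field_ge_2[where 'a='a] by (simp add: power_inject_exp)
qed

section \<open>Transport from normal coordinates to the quadric\<close>

lemma card_invertible_vimage:
  fixes M :: "'a::{field,finite} ^ 5 ^ 5"
  assumes "invertible M"
  shows "card {x. P x} = card {z. P (M *v z)}"
proof -
  have "{x. P x} = (*v) M ` {z. P (M *v z)}"
    using invertible_surj[OF assms] by (auto simp: image_iff) (metis)
  moreover have "inj_on ((*v) M) {z. P (M *v z)}"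
    using invertible_inj[OF assms] by (blast intro: inj_onI)
  ultimately show ?thesis
    by (simp add: card_image)
qed

text \<open>Reduces both cases to vector counts for the normal form \<open>F\<close>. The dichotomy
  \<open>bound\<close> does double duty: it bounds the weights and, because \<open>d > 0\<close>, it
  identifies the kernel as the multiples of \<open>f\<close>, which yields dimension 14.\<close>

lemma is_code_of_normal_form:
  fixes f :: "'a::{field,finite} poly5"
  assumes f: "f \<in> forms 2" "f \<noteq> 0"
    and M: "invertible M" "\<And>z. eval_form f (M *v z) = F z"
    and n: "card {z. F z = 0} = 1 + (CARD('a) - 1) * n"
    and bound: "\<And>g. g \<in> forms 2 \<Longrightarrow> (\<exists>k. \<forall>z. eval_form g z = k * F z) \<or>
      (CARD('a) - 1) * d \<le> card {z. F z = 0 \<and> eval_form g z \<noteq> 0}"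
    and g: "g \<in> forms 2" "card {z. F z = 0 \<and> eval_form g z \<noteq> 0} = (CARD('a) - 1) * d"
    and d: "d > 0"
  shows "is_code (zero_set f) (functional_code (zero_set f)) (int n) 14 (int d)"
proof -
  let ?X = "zero_set f"
  let ?C = "functional_code ?X"
  have q: "CARD('a) - 1 > 0"
    using CARD_field_ge_2[where 'a='a] by simp
  have "card {x. eval_form f x = 0} = card {z. F z = 0}"
    using card_invertible_vimage[OF M(1), of "\<lambda>x. eval_form f x = 0"] M(2) by simp
  then have card_X: "card ?X = n"
    using card_affine_zeros[OF f(1)] n q by simp
  have weight: "(CARD('a) - 1) * weight (codeword ?X h) =
      card {z. F z = 0 \<and> eval_form (coord_change M h) z \<noteq> 0}" if h: "h \<in> forms 2" for h
    unfolding weight_affine[OF f(1) h] eval_form_coord_change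
    using card_invertible_vimage[OF M(1), of "\<lambda>x. eval_form f x = 0 \<and> eval_form h x \<noteq> 0"] M(2) by simp
  have dichotomy: "(\<exists>k. h = const_poly k * f) \<or> d \<le> weight (codeword ?X h)" if h: "h \<in> forms 2" for h
  proof -
    consider k where "\<forall>z. eval_form (coord_change M h) z = k * F z" |
      "(CARD('a) - 1) * d \<le> card {z. F z = 0 \<and> eval_form (coord_change M h) z \<noteq> 0}"
      using bound[OF forms_coord_change[OF h, of M]] by blast
    then show ?thesis
    proof cases
      case (1 k)
      have "eval_form h x = eval_form (const_poly k * f) x" for x
      proof -
        obtain z where "x = M *v z" using invertible_surj[OF M(1)] by blast
        then show ?thesis
          using 1 M(2) by (simp add: eval_form_mult eval_form_coord_change)
      qed
      then have "h = const_poly k * f"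
        using quadratic_form_eq_iff_eval[OF h forms_const_mult[OF f(1), of k]] by blast
      then show ?thesis by blast
    next
      case 2
      then show ?thesis
        using weight[OF h] q by (metis mult_le_cancel1)
    qed
  qed
  have f0: "codeword ?X f = 0"
    using form_value_eq_0_iff[OF f(1)] zero_set_subset[of f] by (auto simp: codeword_def fun_eq_iff)
  have ker: "codeword ?X h = 0 \<longleftrightarrow> (\<exists>k. h = const_poly k * f)" if h: "h \<in> forms 2" for h
  proof
    assume "codeword ?X h = 0"
    then have "weight (codeword ?X h) = 0"
      by (simp add: weight_def)
    then show "\<exists>k. h = const_poly k * f"
      using dichotomy[OF h] d by auto
  next
    assume "\<exists>k. h = const_poly k * f"
    then show "codeword ?X h = 0"
      using f0 by (auto simp: codeword_scale fun_scale_def)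
  qed
  have fin: "finite ?C"
    using card_forms_2[where 'a='a] by (simp add: functional_code_def card_ge_0_finite)
  obtain N where N: "N ** M = mat 1"
    using M(1) invertible_def by blast
  \<comment> \<open>The extremal form lives in normal coordinates; pulling it back along the inverse
    matrix gives a form on the original quadric with the same count.\<close>
  define h where "h = coord_change N g"
  have h: "h \<in> forms 2"
    using g(1) by (simp add: h_def forms_coord_change)
  have "eval_form (coord_change M h) z = eval_form g z" for z
    by (simp add: h_def eval_form_coord_change matrix_vector_mul_assoc N)
  then have weight_h: "weight (codeword ?X h) = d"
    using weight[OF h] g(2) q by simp
  have "min_distance ?C = d"
    unfolding min_distance_def
  proof (rule Min_eqI)
    show "finite (weight ` (?C - {0}))"
      using fin by simp
    show "d \<le> w" if "w \<in> weight ` (?C - {0})" for w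
      using that dichotomy ker by (auto simp: functional_code_def)
    have "codeword ?X h \<noteq> 0"
      using weight_h d by (auto simp: weight_def)
    then show "d \<in> weight ` (?C - {0})"
      using weight_h h by (auto simp: functional_code_def intro!: image_eqI[of _ _ "codeword ?X h"])
  qed
  then show ?thesis
    unfolding is_code_def
    using card_X dim_functional_code[OF f ker] subspace_functional_code[of ?X]
    by (auto simp: functional_code_def codeword_def)
qed

lemma proj_index_obtain:
  fixes f :: "'a::{field,finite} poly5"
  assumes f: "f \<in> forms 2"
  obtains W where "vec.subspace W" "int (vec.dim W) = proj_index (zero_set f) + 1"
    "\<And>x. x \<in> W \<Longrightarrow> eval_form f x = 0"
proof -
  let ?I = "{int (vec.dim W) - 1 | W. vec.subspace W \<and> points_of W \<subseteq> zero_set f}"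
  \<comment> \<open>The zero subspace contains no projective point and contributes dimension -1, so
    the maximum is taken over a nonempty set.\<close>
  have "points_of {0 :: 'a ^ 5} = {}"
    using proj_point_nonzero by (fastforce simp: points_of_def)
  then have "vec.subspace {0 :: 'a ^ 5} \<and> points_of {0 :: 'a ^ 5} \<subseteq> zero_set f"
    by (simp add: vec.subspace_0)
  then have "?I \<noteq> {}" by blast
  moreover have "finite ?I" by simp
  ultimately have "proj_index (zero_set f) \<in> ?I"
    unfolding proj_index_def by (rule Max_in[rotated])
  then obtain W where W: "vec.subspace W" "points_of W \<subseteq> zero_set f"
    "proj_index (zero_set f) = int (vec.dim W) - 1" by blast
  have "eval_form f x = 0" if x: "x \<in> W" for x
  proof (cases "x = 0")
    case True
    then show ?thesis by (simp add: eval_form_quadratic_zero f)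
  next
    case False
    have "vec.span {x} \<subseteq> W"
      using x W(1) by (intro vec.span_minimal) auto
    then have "vec.span {x} \<in> zero_set f"
      using W(2) False by (auto simp: points_of_def proj_points_def)
    then show ?thesis
      by (simp add: zero_set_def vec.span_base)
  qed
  with W that show ?thesis by simp
qed

text \<open>In rank 3 the code parameters are asserted for \<open>q \<ge> 4\<close>: a nonzero
  codeword has positive weight, whereas \<open>q^3 - 3 * q^2\<close> is 0 for \<open>q = 3\<close>
  and -4 for \<open>q = 2\<close>. The number of points is given for all \<open>q\<close>.\<close>

theorem theorem4p4:
  fixes f :: "('a::{field,finite}) poly5"
    and X :: "('a ^ 5) set set"
    and q :: int
  assumes q: "q = int CARD('a)"
    and quadric: "f \<in> forms 2" "f \<noteq> 0" "X = zero_set f"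
    and degenerate: "degenerate_form f"
  shows "(form_rank f = 3 \<longrightarrow>
            int (card X) = q ^ 3 + q ^ 2 + q + 1 \<and>
            (q \<ge> 4 \<longrightarrow>
               is_code X (functional_code X) (q ^ 3 + q ^ 2 + q + 1) 14 (q ^ 3 - 3 * q ^ 2)))
       \<and> (form_rank f = 4 \<and> proj_index X = 2 \<longrightarrow>
            is_code X (functional_code X) (q ^ 3 + 2 * q ^ 2 + q + 1) 14 (q ^ 3 - 2 * q ^ 2 + q))"
proof (intro conjI impI)
  let ?q = "CARD('a)"
  obtain r where r: "?q = r + 2"
    using CARD_field_ge_2[where 'a='a] by (metis add.commute le_Suc_ex)
  note Q = quadratic_map_eval_form[OF quadric(1)]
  {
    assume rank: "form_rank f = 3"
    then have "vec.dim (quadratic_map.radical (eval_form f)) = 2"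
      using form_rank_eq[OF quadric(1)] by simp
    then obtain M :: "'a ^ 5 ^ 5" and c where M: "invertible M" "\<And>z. eval_form f (M *v z) = z $ 0 * z $ 1 + c * (z $ 2)\<^sup>2"
      and c: "c \<noteq> 0"
      using conic_cone_normal_form[OF Q] by blast
    have n: "card {z :: 'a ^ 5. z $ 0 * z $ 1 + c * (z $ 2)\<^sup>2 = 0} =
        1 + (?q - 1) * (?q ^ 3 + ?q\<^sup>2 + ?q + 1)"
      unfolding card_conic_cone[OF c] r by (simp add: numeral_eq_Suc algebra_simps)
    have "(?q - 1) * card X = (?q - 1) * (?q ^ 3 + ?q\<^sup>2 + ?q + 1)"
      using card_affine_zeros[OF quadric(1)] n M(2) quadric(3)
        card_invertible_vimage[OF M(1), of "\<lambda>x. eval_form f x = 0"] by simp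
    then have "card X = ?q ^ 3 + ?q\<^sup>2 + ?q + 1"
      using r by (metis add_2_eq_Suc' diff_Suc_1 mult_cancel1 nat.distinct(1))
    then show "int (card X) = q ^ 3 + q ^ 2 + q + 1"
      by (simp add: q)
    assume "q \<ge> 4"
    then have q4: "?q \<ge> 4" by (simp add: q)
    \<comment> \<open>A third field element \<open>k\<close> is needed as the fourth parameter, next
      to 0, 1 and infinity, at which the extremal form vanishes.\<close>
    have "{0, 1 :: 'a} \<noteq> UNIV"
    proof
      assume "{0, 1 :: 'a} = UNIV"
      then have "card {0, 1 :: 'a} = ?q" by (rule arg_cong)
      then show False using q4 by simp
    qed
    then obtain k :: 'a where k: "k \<noteq> 0" "k \<noteq> 1" by blast
    define g where "g = indet 2 * (indet 1 + const_poly (c * (1 + k)) * indet 2 + const_poly (- c * k) * indet 0)"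
    have "g \<in> forms (1 + 1)"
      unfolding g_def by (intro forms_mult forms_add forms_const_mult forms_indet)
    then have g: "g \<in> forms 2" by (simp only: one_add_one)
    have eval_g: "eval_form g z = z $ 2 * (z $ 1 + c * (1 + k) * z $ 2 - c * k * z $ 0)" for z
      by (simp add: g_def eval_form_mult eval_form_add)
    have "is_code X (functional_code X) (int (?q ^ 3 + ?q\<^sup>2 + ?q + 1)) 14 (int ((?q - 3) * ?q\<^sup>2))"
      unfolding quadric(3)
    proof (rule is_code_of_normal_form[OF quadric(1,2) M n])
      show "card {z. z $ 0 * z $ 1 + c * (z $ 2)\<^sup>2 = 0 \<and> eval_form g z \<noteq> 0} =
          (?q - 1) * ((?q - 3) * ?q\<^sup>2)"
        unfolding eval_g by (rule card_conic_cone_minus_four_planes[OF c k])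
    qed (use conic_cone_nonzeros[OF _ c q4] g q4 in auto)
    moreover have "int ((?q - 3) * ?q\<^sup>2) = q ^ 3 - 3 * q\<^sup>2"
      using q4 by (simp add: q of_nat_diff power2_eq_square power3_eq_cube algebra_simps)
    moreover have "int (?q ^ 3 + ?q\<^sup>2 + ?q + 1) = q ^ 3 + q\<^sup>2 + q + 1"
      by (simp add: q)
    ultimately show "is_code X (functional_code X) (q ^ 3 + q ^ 2 + q + 1) 14 (q ^ 3 - 3 * q ^ 2)"
      by (simp only:)
  next
    assume rank: "form_rank f = 4 \<and> proj_index X = 2"
    then have dim: "vec.dim (quadratic_map.radical (eval_form f)) = 1"
      using form_rank_eq[OF quadric(1)] by simp
    obtain W where "vec.subspace W" "vec.dim W = 3" "\<And>x. x \<in> W \<Longrightarrow> eval_form f x = 0"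
      using proj_index_obtain[OF quadric(1)] rank quadric(3) by auto
    then obtain M :: "'a ^ 5 ^ 5" where M: "invertible M" "\<And>z. eval_form f (M *v z) = z $ 0 * z $ 1 - z $ 2 * z $ 3"
      using hyperbolic_cone_normal_form[OF Q dim] by blast
    have n: "card {z :: 'a ^ 5. z $ 0 * z $ 1 - z $ 2 * z $ 3 = 0} =
        1 + (?q - 1) * (?q ^ 3 + 2 * ?q\<^sup>2 + ?q + 1)"
      using card_hyperbolic_cone[where 'a='a] unfolding r by (simp add: numeral_eq_Suc algebra_simps)
    have "indet 0 * indet 1 \<in> forms (1 + 1)"
      by (intro forms_mult forms_indet)
    then have g: "indet 0 * indet 1 \<in> forms 2" by (simp only: one_add_one)
    have "is_code X (functional_code X) (int (?q ^ 3 + 2 * ?q\<^sup>2 + ?q + 1)) 14 (int (?q * (?q - 1)\<^sup>2))"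
      unfolding quadric(3)
    proof (rule is_code_of_normal_form[OF quadric(1,2) M n])
      show "card {z :: 'a ^ 5. z $ 0 * z $ 1 - z $ 2 * z $ 3 = 0 \<and> eval_form (indet 0 * indet 1) z \<noteq> 0} =
          (?q - 1) * (?q * (?q - 1)\<^sup>2)"
        unfolding eval_form_mult eval_form_indet by (rule card_hyperbolic_cone_minus_four_planes)
      show "?q * (?q - 1)\<^sup>2 > 0"
        using r by simp
      show "(\<exists>k. \<forall>z. eval_form h z = k * (z $ 0 * z $ 1 - z $ 2 * z $ 3)) \<or>
          (?q - 1) * (?q * (?q - 1)\<^sup>2) \<le> card {z. z $ 0 * z $ 1 - z $ 2 * z $ 3 = 0 \<and> eval_form h z \<noteq> 0}"
        if "h \<in> forms 2" for h :: "'a poly5"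
        using that by (rule hyperbolic_cone_nonzeros)
    qed (rule g)
    moreover have "int (?q * (?q - 1)\<^sup>2) = q ^ 3 - 2 * q\<^sup>2 + q"
      by (simp add: q r power2_eq_square power3_eq_cube algebra_simps)
    moreover have "int (?q ^ 3 + 2 * ?q\<^sup>2 + ?q + 1) = q ^ 3 + 2 * q\<^sup>2 + q + 1"
      by (simp add: q)
    ultimately show "is_code X (functional_code X) (q ^ 3 + 2 * q ^ 2 + q + 1) 14 (q ^ 3 - 2 * q ^ 2 + q)"
      by (simp only:)
  }
qed

end
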